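(* Let $\Delta$ be a locally finite semiregular right-angled building over a finite index set $I$ with a fixed legal coloring $\lambda$, and let $\mathbf F=(F_i)_{i\in I}$, $\acute{\mathbf F}=(\acute F_i)_{i\in I}$ be local data with $F_i\leq\acute F_i\leq\widehat F_i\leq\operatorname{Sym}(\Omega_i)$ for every $i\in I$. Let $\mathscr H$ be a set of representatives of harmonious panels of $\Delta$ that are not rungs (that is, $\mathscr H$ contains exactly one panel from each class of the equivalence relation "of the same type and harmonious with respect to $\mathbf F$" on the set of panels of $\Delta$ that are not rungs). Then $$\mathcal G(\mathbf F,\acute{\mathbf F})=\bigl\langle\, \mathcal U(\mathbf F),\ K_{\mathcal P}\ \bigm|\ \mathcal P\in\mathscr H\,\bigr\rangle .$$
   Context: Let $I$ be a finite set and $M=(m_{ij})_{i,j\in I}$ a right-angled Coxeter matrix: $m_{ii}=1$ and $m_{ij}\in\{2,\infty\}$ for $i\neq j$. $\Delta$ is a semiregular right-angled building of type $M$ with parameters $(q_i)_{i\in I}$ (each $i$-panel, i.e. residue of type $\{i\}$, has exactly $q_i$ chambers); it is identified with its set of chambers. Locally finite: all $q_i$ are finite. $\operatorname{Aut}(\Delta)$ is the group of type-preserving automorphisms. Legal coloring: for each $i$ let $\Omega_i$ be a set of cardinality $q_i$; a legal coloring is a map $\lambda=(\lambda_i)_{i\in I}\colon\Delta\to\prod_{i\in I}\Omega_i$ such that for each $i$-panel $\mathcal P$ the restriction $\lambda_i|_{\mathcal P}\colon \mathcal P\to\Omega_i$ is a bijection and $\lambda_j|_{\mathcal P}$ is constant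 for every $j\neq i$. The local action of $g\in\operatorname{Aut}(\Delta)$ at an $i$-panel $\mathcal P$ is $\sigma_\lambda(g,\mathcal P)=\lambda_i|_{g\mathcal P}\circ g|_{\mathcal P}\circ(\lambda_i|_{\mathcal P})^{-1}\in\operatorname{Sym}(\Omega_i)$. Local data $\mathbf F$: a family of permutation groups $F_i\leq\operatorname{Sym}(\Omega_i)$, $i\in I$. $\widehat F_i$ is the Young overgroup of $F_i$: the group of all permutations of $\Omega_i$ stabilizing each $F_i$-orbit. $\mathcal U(\mathbf F)$ is the group of $g\in\operatorname{Aut}(\Delta)$ with $\sigma_\lambda(g,\mathcal P)\in F_i$ for all $i$ and all $i$-panels $\mathcal P$ (similarly $\mathcal U(\acute{\mathbf F})$). $\mathcal G(\mathbf F)$ is the group of $g\in\operatorname{Aut}(\Delta)$ such that for every $i\in I$, $\sigma_\lambda(g,\mathcal P)\in F_i$ for all but finitely many $i$-panels $\mathcal P$. $\mathcal G(\mathbf F,\acute{\mathbf F})=\mathcal G(\mathbf F)\cap\mathcal U(\acute{\mathbf F})$. A singularity of $g\in\mathcal G(\mathbf F,\acute{\mathbf F})$ is an $i$-panel $\mathcal P$ (for some $i$) with $\sigma_\lambda(g,\mathcal P)\notin F_i$. Two residues are parallel if $\operatorname{proj}_{\mathcal R_1}(\mathcal R_2)=\mathcal R_1$ and $\operatorname{proj}_{\mathcal R_2}(\mathcal R_1)=\mathcal R_2$, where $\operatorname{proj}_{\mathcal R}(c)$ is the unique chamber of $\mathcal R$ closest to $c$. For a panel $\mathcal P$, $K_{\mathcal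 P}$ is the subgroup of all $g\in\mathcal G(\mathbf F,\acute{\mathbf F})$ that stabilize $\mathcal P$ (setwise) and all of whose singularities are parallel to $\mathcal P$. Two $j$-panels $\mathcal P,\mathcal P'$ are harmonious (with respect to $\mathbf F$) if for each $k\in I\setminus\{j\}$ the (constant) colors $\lambda_k(\mathcal P)$ and $\lambda_k(\mathcal P')$ lie in the same $F_k$-orbit. An $i$-panel is a rung (of a ladder in $\Delta$) if there exist $j,k\in I$ with $m_{ij}=m_{ik}=2$ and $m_{jk}=\infty$. *)

theory Defs
  imports
    "HOL-Library.Extended_Nat"
    "HOL-Algebra.Bij"
    "HOL-Algebra.Generated_Groups"
    "HOL-Algebra.Group_Action"
begin

section \<open>Coxeter groups\<close>

definition coxeter_matrix :: "'i set \<Rightarrow> ('i \<Rightarrow> 'i \<Rightarrow> enat) \<Rightarrow> bool" where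
  "coxeter_matrix I m \<longleftrightarrow>
     (\<forall>i\<in>I. m i i = 1) \<and>
     (\<forall>i\<in>I. \<forall>j\<in>I. i \<noteq> j \<longrightarrow> m i j = m j i \<and> 2 \<le> m i j)"

definition right_angled :: "'i set \<Rightarrow> ('i \<Rightarrow> 'i \<Rightarrow> enat) \<Rightarrow> bool" where
  "right_angled I m \<longleftrightarrow> (\<forall>i\<in>I. \<forall>j\<in>I. i \<noteq> j \<longrightarrow> m i j = 2 \<or> m i j = \<infinity>)"

text \<open>
  The Coxeter group is the quotient of the free monoid on \<open>I\<close> by the congruence generated by
  \<open>(i j)\<^sup>n = 1\<close> with \<open>n = m i j\<close> finite. Since \<open>m i i = 1\<close> makes every generator an
  involution, this monoid presentation defines the usual group.
\<close>

inductive_set coxeter_rel :: "'i set \<Rightarrow> ('i \<Rightarrow> 'i \<Rightarrow> enat) \<Rightarrow> ('i list \<times> 'i list) set"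
  for I :: "'i set" and m :: "'i \<Rightarrow> 'i \<Rightarrow> enat" where
  relator: "\<lbrakk>i \<in> I; j \<in> I; m i j = enat n; u \<in> lists I; v \<in> lists I\<rbrakk>
      \<Longrightarrow> (u @ concat (replicate n [i, j]) @ v, u @ v) \<in> coxeter_rel I m"
| refl: "u \<in> lists I \<Longrightarrow> (u, u) \<in> coxeter_rel I m"
| sym: "(u, v) \<in> coxeter_rel I m \<Longrightarrow> (v, u) \<in> coxeter_rel I m"
| trans: "\<lbrakk>(u, v) \<in> coxeter_rel I m; (v, w) \<in> coxeter_rel I m\<rbrakk> \<Longrightarrow> (u, w) \<in> coxeter_rel I m"

definition coxeter_group :: "'i set \<Rightarrow> ('i \<Rightarrow> 'i \<Rightarrow> enat) \<Rightarrow> 'i list set set" where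
  "coxeter_group I m = lists I // coxeter_rel I m"

definition reduced_word :: "'i set \<Rightarrow> ('i \<Rightarrow> 'i \<Rightarrow> enat) \<Rightarrow> 'i list \<Rightarrow> bool" where
  "reduced_word I m f \<longleftrightarrow>
     f \<in> lists I \<and> (\<forall>g. (f, g) \<in> coxeter_rel I m \<longrightarrow> length f \<le> length g)"


section \<open>Chamber systems and buildings\<close>

record ('i, 'c) chamber_system =
  index_set :: "'i set"
  chambers :: "'c set"
  adj :: "'i \<Rightarrow> ('c \<times> 'c) set"

definition is_chamber_system :: "('i, 'c) chamber_system \<Rightarrow> bool" where
  "is_chamber_system D \<longleftrightarrow>
     chambers D \<noteq> {} \<and> (\<forall>i\<in>index_set D. equiv (chambers D) (adj D i))"

text \<open>Galleries do not stutter: consecutive chambers are adjacent and distinct.\<close>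

fun gallery :: "('i, 'c) chamber_system \<Rightarrow> 'i list \<Rightarrow> 'c \<Rightarrow> 'c \<Rightarrow> bool" where
  "gallery D [] x y \<longleftrightarrow> x \<in> chambers D \<and> x = y"
| "gallery D (i # w) x y \<longleftrightarrow>
     i \<in> index_set D \<and> (\<exists>z. (x, z) \<in> adj D i \<and> x \<noteq> z \<and> gallery D w z y)"

definition residue :: "('i, 'c) chamber_system \<Rightarrow> 'i set \<Rightarrow> 'c \<Rightarrow> 'c set" where
  "residue D J x = {y. \<exists>w\<in>lists J. gallery D w x y}"

definition panels :: "('i, 'c) chamber_system \<Rightarrow> 'i \<Rightarrow> 'c set set" where
  "panels D i = residue D {i} ` chambers D"

text \<open>
  A building of type \<open>m\<close> is a chamber system whose panels have at least two chambers, with a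
  Weyl distance \<open>\<delta>\<close> valued in the Coxeter group: for reduced \<open>f\<close>, \<open>\<delta> x y\<close> is the element
  represented by \<open>f\<close> if and only if there is a gallery of type \<open>f\<close> from \<open>x\<close> to \<open>y\<close>.
\<close>

definition is_building ::
  "('i \<Rightarrow> 'i \<Rightarrow> enat) \<Rightarrow> ('i, 'c) chamber_system \<Rightarrow> ('c \<Rightarrow> 'c \<Rightarrow> 'i list set) \<Rightarrow> bool" where
  "is_building m D \<delta> \<longleftrightarrow>
     coxeter_matrix (index_set D) m \<and>
     is_chamber_system D \<and>
     (\<forall>i\<in>index_set D. \<forall>P\<in>panels D i. \<exists>x\<in>P. \<exists>y\<in>P. x \<noteq> y) \<and>
     (\<forall>x\<in>chambers D. \<forall>y\<in>chambers D. \<delta> x y \<in> coxeter_group (index_set D) m) \<and>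
     (\<forall>f. reduced_word (index_set D) m f \<longrightarrow>
        (\<forall>x\<in>chambers D. \<forall>y\<in>chambers D.
           \<delta> x y = coxeter_rel (index_set D) m `` {f} \<longleftrightarrow> gallery D f x y))"

definition right_angled_building ::
  "('i \<Rightarrow> 'i \<Rightarrow> enat) \<Rightarrow> ('i, 'c) chamber_system \<Rightarrow> ('c \<Rightarrow> 'c \<Rightarrow> 'i list set) \<Rightarrow> bool" where
  "right_angled_building m D \<delta> \<longleftrightarrow> right_angled (index_set D) m \<and> is_building m D \<delta>"

text \<open>The parameters are natural numbers, so this includes local finiteness.\<close>

definition semiregular :: "('i, 'c) chamber_system \<Rightarrow> ('i \<Rightarrow> nat) \<Rightarrow> bool" where
  "semiregular D q \<longleftrightarrow> (\<forall>i\<in>index_set D. \<forall>P\<in>panels D i. finite P \<and> card P = q i)"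

definition gallery_dist :: "('i, 'c) chamber_system \<Rightarrow> 'c \<Rightarrow> 'c \<Rightarrow> nat" where
  "gallery_dist D x y = (LEAST n. \<exists>w. length w = n \<and> gallery D w x y)"

definition chamber_proj :: "('i, 'c) chamber_system \<Rightarrow> 'c set \<Rightarrow> 'c \<Rightarrow> 'c" where
  "chamber_proj D R c = (THE d. is_arg_min (gallery_dist D c) (\<lambda>d. d \<in> R) d)"

definition parallel :: "('i, 'c) chamber_system \<Rightarrow> 'c set \<Rightarrow> 'c set \<Rightarrow> bool" where
  "parallel D R R' \<longleftrightarrow> chamber_proj D R ` R' = R \<and> chamber_proj D R' ` R = R'"

definition is_rung :: "('i \<Rightarrow> 'i \<Rightarrow> enat) \<Rightarrow> ('i, 'c) chamber_system \<Rightarrow> 'c set \<Rightarrow> bool" where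
  "is_rung m D P \<longleftrightarrow>
     (\<exists>i\<in>index_set D. P \<in> panels D i \<and>
        (\<exists>j\<in>index_set D. \<exists>k\<in>index_set D. m i j = 2 \<and> m i k = 2 \<and> m j k = \<infinity>))"


section \<open>Automorphisms, colorings and local actions\<close>

definition aut :: "('i, 'c) chamber_system \<Rightarrow> ('c \<Rightarrow> 'c) set" where
  "aut D = {g \<in> Bij (chambers D).
     \<forall>i\<in>index_set D. \<forall>x\<in>chambers D. \<forall>y\<in>chambers D.
       (g x, g y) \<in> adj D i \<longleftrightarrow> (x, y) \<in> adj D i}"

definition Aut_group :: "('i, 'c) chamber_system \<Rightarrow> ('c \<Rightarrow> 'c) monoid" where
  "Aut_group D = BijGroup (chambers D) \<lparr>carrier := aut D\<rparr>"

definition legal_coloring ::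
  "('i, 'c) chamber_system \<Rightarrow> ('i \<Rightarrow> 'o set) \<Rightarrow> ('i \<Rightarrow> 'c \<Rightarrow> 'o) \<Rightarrow> bool" where
  "legal_coloring D \<Omega> lam \<longleftrightarrow>
     (\<forall>i\<in>index_set D. lam i \<in> chambers D \<rightarrow> \<Omega> i) \<and>
     (\<forall>i\<in>index_set D. \<forall>P\<in>panels D i.
        bij_betw (lam i) P (\<Omega> i) \<and>
        (\<forall>j\<in>index_set D - {i}. \<forall>x\<in>P. \<forall>y\<in>P. lam j x = lam j y))"

definition local_action ::
  "('i \<Rightarrow> 'o set) \<Rightarrow> ('i \<Rightarrow> 'c \<Rightarrow> 'o) \<Rightarrow> 'i \<Rightarrow> ('c \<Rightarrow> 'c) \<Rightarrow> 'c set \<Rightarrow> 'o \<Rightarrow> 'o" where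
  "local_action \<Omega> lam i g P = (\<lambda>a\<in>\<Omega> i. lam i (g (inv_into P (lam i) a)))"

definition perm_orbits :: "'o set \<Rightarrow> ('o \<Rightarrow> 'o) set \<Rightarrow> 'o set set" where
  "perm_orbits A G = orbits (BijGroup A \<lparr>carrier := G\<rparr>) A (\<lambda>p. p)"

definition young_overgroup :: "'o set \<Rightarrow> ('o \<Rightarrow> 'o) set \<Rightarrow> ('o \<Rightarrow> 'o) set" where
  "young_overgroup A G = {p \<in> Bij A. \<forall>B\<in>perm_orbits A G. p ` B = B}"

definition local_data :: "'i set \<Rightarrow> ('i \<Rightarrow> 'o set) \<Rightarrow> ('i \<Rightarrow> ('o \<Rightarrow> 'o) set) \<Rightarrow> bool" where
  "local_data I \<Omega> F \<longleftrightarrow> (\<forall>i\<in>I. subgroup (F i) (BijGroup (\<Omega> i)))"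


section \<open>Universal and restricted universal groups\<close>

definition univ_group ::
  "('i, 'c) chamber_system \<Rightarrow> ('i \<Rightarrow> 'o set) \<Rightarrow> ('i \<Rightarrow> 'c \<Rightarrow> 'o) \<Rightarrow>
   ('i \<Rightarrow> ('o \<Rightarrow> 'o) set) \<Rightarrow> ('c \<Rightarrow> 'c) set" where
  "univ_group D \<Omega> lam F =
     {g \<in> aut D. \<forall>i\<in>index_set D. \<forall>P\<in>panels D i. local_action \<Omega> lam i g P \<in> F i}"

definition almost_univ_group ::
  "('i, 'c) chamber_system \<Rightarrow> ('i \<Rightarrow> 'o set) \<Rightarrow> ('i \<Rightarrow> 'c \<Rightarrow> 'o) \<Rightarrow>
   ('i \<Rightarrow> ('o \<Rightarrow> 'o) set) \<Rightarrow> ('c \<Rightarrow> 'c) set" where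
  "almost_univ_group D \<Omega> lam F =
     {g \<in> aut D. \<forall>i\<in>index_set D. finite {P \<in> panels D i. local_action \<Omega> lam i g P \<notin> F i}}"

definition restricted_univ_group ::
  "('i, 'c) chamber_system \<Rightarrow> ('i \<Rightarrow> 'o set) \<Rightarrow> ('i \<Rightarrow> 'c \<Rightarrow> 'o) \<Rightarrow>
   ('i \<Rightarrow> ('o \<Rightarrow> 'o) set) \<Rightarrow> ('i \<Rightarrow> ('o \<Rightarrow> 'o) set) \<Rightarrow> ('c \<Rightarrow> 'c) set" where
  "restricted_univ_group D \<Omega> lam F F' = almost_univ_group D \<Omega> lam F \<inter> univ_group D \<Omega> lam F'"

definition singularities ::
  "('i, 'c) chamber_system \<Rightarrow> ('i \<Rightarrow> 'o set) \<Rightarrow> ('i \<Rightarrow> 'c \<Rightarrow> 'o) \<Rightarrow>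
   ('i \<Rightarrow> ('o \<Rightarrow> 'o) set) \<Rightarrow> ('c \<Rightarrow> 'c) \<Rightarrow> 'c set set" where
  "singularities D \<Omega> lam F g =
     {P. \<exists>i\<in>index_set D. P \<in> panels D i \<and> local_action \<Omega> lam i g P \<notin> F i}"

definition panel_group ::
  "('i, 'c) chamber_system \<Rightarrow> ('i \<Rightarrow> 'o set) \<Rightarrow> ('i \<Rightarrow> 'c \<Rightarrow> 'o) \<Rightarrow>
   ('i \<Rightarrow> ('o \<Rightarrow> 'o) set) \<Rightarrow> ('i \<Rightarrow> ('o \<Rightarrow> 'o) set) \<Rightarrow> 'c set \<Rightarrow> ('c \<Rightarrow> 'c) set" where
  "panel_group D \<Omega> lam F F' P =
     {g \<in> restricted_univ_group D \<Omega> lam F F'.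
        g ` P = P \<and> (\<forall>Q\<in>singularities D \<Omega> lam F g. parallel D Q P)}"


section \<open>Harmonious panels\<close>

text \<open>
  For \<open>k \<noteq> j\<close> the color \<open>lam k\<close> is constant on a \<open>j\<close>-panel, so comparing arbitrary chambers
  of the two panels compares the colors of the panels.
\<close>

definition harmonious ::
  "('i, 'c) chamber_system \<Rightarrow> ('i \<Rightarrow> 'o set) \<Rightarrow> ('i \<Rightarrow> 'c \<Rightarrow> 'o) \<Rightarrow>
   ('i \<Rightarrow> ('o \<Rightarrow> 'o) set) \<Rightarrow> 'i \<Rightarrow> 'c set \<Rightarrow> 'c set \<Rightarrow> bool" where
  "harmonious D \<Omega> lam F j P P' \<longleftrightarrow>
     P \<in> panels D j \<and> P' \<in> panels D j \<and>
     (\<forall>k\<in>index_set D - {j}. \<forall>x\<in>P. \<forall>y\<in>P'.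
        \<exists>B\<in>perm_orbits (\<Omega> k) (F k). lam k x \<in> B \<and> lam k y \<in> B)"

definition nonrung_panels ::
  "('i \<Rightarrow> 'i \<Rightarrow> enat) \<Rightarrow> ('i, 'c) chamber_system \<Rightarrow> 'c set set" where
  "nonrung_panels m D = {P \<in> (\<Union>i\<in>index_set D. panels D i). \<not> is_rung m D P}"

definition harmony_rel ::
  "('i \<Rightarrow> 'i \<Rightarrow> enat) \<Rightarrow> ('i, 'c) chamber_system \<Rightarrow> ('i \<Rightarrow> 'o set) \<Rightarrow> ('i \<Rightarrow> 'c \<Rightarrow> 'o) \<Rightarrow>
   ('i \<Rightarrow> ('o \<Rightarrow> 'o) set) \<Rightarrow> ('c set \<times> 'c set) set" where
  "harmony_rel m D \<Omega> lam F =
     {(P, P'). P \<in> nonrung_panels m D \<and> P' \<in> nonrung_panels m D \<and>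
        (\<exists>j\<in>index_set D. harmonious D \<Omega> lam F j P P')}"

definition harmony_representatives ::
  "('i \<Rightarrow> 'i \<Rightarrow> enat) \<Rightarrow> ('i, 'c) chamber_system \<Rightarrow> ('i \<Rightarrow> 'o set) \<Rightarrow> ('i \<Rightarrow> 'c \<Rightarrow> 'o) \<Rightarrow>
   ('i \<Rightarrow> ('o \<Rightarrow> 'o) set) \<Rightarrow> 'c set set \<Rightarrow> bool" where
  "harmony_representatives m D \<Omega> lam F H \<longleftrightarrow>
     H \<subseteq> nonrung_panels m D \<and>
     (\<forall>X \<in> nonrung_panels m D // harmony_rel m D \<Omega> lam F. \<exists>!P. P \<in> H \<inter> X)"

end

theory Submission
  imports Defs
begin

text \<open>
  In a right-angled building every closed gallery contracts through commutations of adjacent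
  commuting types, so flat transport along galleries has no monodromy. Applied to chambers with
  prescribed colors, this shows that for two legal colorings \<open>\<lambda>\<close>, \<open>\<mu>\<close>
  with \<open>\<mu> c = \<lambda> c'\<close> there is an automorphism \<open>g\<close> with
  \<open>g c = c'\<close> and \<open>\<lambda> \<circ> g = \<mu>\<close>; constructing automorphisms thus
  reduces to writing down colorings.

  The local action of an automorphism is constant along the wall of an \<open>i\<close>-panel, that is,
  the residue of type \<open>i\<close> together with all types commuting with \<open>i\<close>. The wall of a
  rung is infinite, so singularities are never rungs. Given a singular panel of \<open>g\<close>, move a
  harmonious representative \<open>P\<close> onto it by an element \<open>u\<close> of the universal group,
  and divide \<open>g u\<close> by an element of \<open>K\<^sub>P\<close> with the same local action along the
  wall of \<open>P\<close>. This removes the singularities on that wall and creates no new ones, so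
  induction on the number of singularities applies.
\<close>

section \<open>Words in right-angled Coxeter groups\<close>

text \<open>The building axioms produce galleries only for reduced types, so contracting galleries
  first requires a lower bound on word lengths; this is why the word problem is treated separately.

  The inclusion of \<open>F' i\<close> in the Young overgroup of \<open>F i\<close> is what makes
  the correcting automorphism exist. An action \<open>a\<close> prescribed on a wall forces, on each
  wing, an action agreeing with \<open>a\<close> at one color. Such an action can be chosen in
  \<open>F i\<close> because \<open>a\<close> preserves the orbits of \<open>F i\<close>.

  The corrector must also have only finitely many singularities. This is not read off from the type
  of the panel: the corrector is built on a panel that is singular for an element of the group, so
  its wall consists of singular panels of that element and is finite. That rungs are never singular
  serves to guarantee that \<open>H\<close> contains a representative.

  Correctors are available only at the representatives, hence the detour through \<open>u\<close>.
  Since the local actions of \<open>u\<close> lie in \<open>F\<close>, composing with it merely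
  relocates singularities.\<close>

locale commutation =
  fixes comm :: "'i \<Rightarrow> 'i \<Rightarrow> bool"
  assumes comm_sym: "comm i j \<Longrightarrow> comm j i"
    and comm_irrefl: "\<not> comm i i"
begin

text \<open>Detects whether the first occurrence of \<open>i\<close> can be moved to the front by
  commutations alone.\<close>

fun initial :: "'i \<Rightarrow> 'i list \<Rightarrow> bool" where
  "initial i [] \<longleftrightarrow> False"
| "initial i (j # w) \<longleftrightarrow> j = i \<or> comm i j \<and> initial i w"

text \<open>No letter can be cancelled against an equal letter further right by commutations. This
  is a local test for being reduced, see \<open>irreducible_reduced\<close>.\<close>

fun irreducible :: "'i list \<Rightarrow> bool" where
  "irreducible [] \<longleftrightarrow> True"
| "irreducible (i # w) \<longleftrightarrow> \<not> initial i w \<and> irreducible w"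

text \<open>Left multiplication by a generator, as an action on irreducible words up to
  commutations. Letting the presentation act in this way bounds word lengths from below without a
  confluence argument.\<close>

definition lmult :: "'i \<Rightarrow> 'i list \<Rightarrow> 'i list" where
  "lmult i w = (if initial i w then remove1 i w else i # w)"

text \<open>
  Words that agree up to commutations have the same projections to all pairs of non-commuting
  letters; comparing projections avoids choosing normal forms.
\<close>

definition trace_eq :: "'i list \<Rightarrow> 'i list \<Rightarrow> bool" where
  "trace_eq u v \<longleftrightarrow>
     (\<forall>j k. \<not> comm j k \<longrightarrow> filter (\<lambda>x. x = j \<or> x = k) u = filter (\<lambda>x. x = j \<or> x = k) v)"

lemma trace_eqD: "trace_eq u v \<Longrightarrow> \<not> comm j k \<Longrightarrow>
    filter (\<lambda>x. x = j \<or> x = k) u = filter (\<lambda>x. x = j \<or> x = k) v"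
  by (simp add: trace_eq_def)

lemma trace_eq_refl [simp]: "trace_eq u u"
  by (simp add: trace_eq_def)

lemma trace_eq_sym: "trace_eq u v \<Longrightarrow> trace_eq v u"
  by (simp add: trace_eq_def)

lemma trace_eq_trans [trans]: "trace_eq u v \<Longrightarrow> trace_eq v w \<Longrightarrow> trace_eq u w"
  by (simp add: trace_eq_def)

text \<open>Expresses \<open>initial\<close> through projections alone, hence its invariance under
  \<open>trace_eq\<close>. A letter in front of \<open>i\<close> that blocks it would head the
  projection to itself and \<open>i\<close>; the choice \<open>j = i\<close>, allowed because
  \<open>comm\<close> is irreflexive, forces \<open>i\<close> to occur.\<close>

lemma initial_iff_filter:
  "initial i w \<longleftrightarrow> (\<forall>j. \<not> comm i j \<longrightarrow> (\<exists>v. filter (\<lambda>x. x = i \<or> x = j) w = i # v))"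
proof (induction w)
  case Nil
  then show ?case using comm_irrefl by auto
next
  case (Cons k w)
  consider "k = i" | "k \<noteq> i" "comm i k" | "k \<noteq> i" "\<not> comm i k" by blast
  then show ?case
  proof cases
    case 2
    then have "filter (\<lambda>x. x = i \<or> x = j) (k # w) = filter (\<lambda>x. x = i \<or> x = j) w"
      if "\<not> comm i j" for j
      using that by auto
    with Cons 2 show ?thesis by auto
  next
    case 3
    then show ?thesis by auto
  qed simp
qed

lemma initial_cong: "trace_eq u v \<Longrightarrow> initial i u \<longleftrightarrow> initial i v"
  unfolding initial_iff_filter by (metis trace_eqD)

lemma initial_remove1:
  assumes "comm i j"
  shows "initial i (remove1 j w) \<longleftrightarrow> initial i w"
proof -
  have "filter (\<lambda>x. x = i \<or> x = k) (remove1 j w) = filter (\<lambda>x. x = i \<or> x = k) w"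
    if "\<not> comm i k" for k
  proof -
    from assms that comm_irrefl have "j \<noteq> i" "j \<noteq> k" by auto
    then show ?thesis by (simp add: filter_remove1 remove1_idem)
  qed
  then show ?thesis unfolding initial_iff_filter by metis
qed

lemma irreducible_remove1: "irreducible w \<Longrightarrow> initial i w \<Longrightarrow> irreducible (remove1 i w)"
  by (induction w) (auto simp: initial_remove1 comm_sym)

lemma not_initial_remove1: "irreducible w \<Longrightarrow> initial i w \<Longrightarrow> \<not> initial i (remove1 i w)"
  by (induction w) auto

lemma irreducible_lmult: "irreducible w \<Longrightarrow> irreducible (lmult i w)"
  by (simp add: lmult_def irreducible_remove1)

text \<open>A projection involving \<open>i\<close> already begins with \<open>i\<close>, and
  \<open>remove1\<close> deletes exactly that letter; all other projections do not see
  \<open>i\<close>.\<close>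

lemma trace_eq_Cons_remove1:
  assumes "initial i w"
  shows "trace_eq (i # remove1 i w) w"
  unfolding trace_eq_def
proof (intro allI impI)
  fix j k assume jk: "\<not> comm j k"
  show "filter (\<lambda>x. x = j \<or> x = k) (i # remove1 i w) = filter (\<lambda>x. x = j \<or> x = k) w"
  proof (cases "i = j \<or> i = k")
    case True
    then obtain l where l: "\<not> comm i l" "(\<lambda>x. x = j \<or> x = k) = (\<lambda>x. x = i \<or> x = l)"
      using jk comm_sym by (metis (no_types, lifting))
    then obtain v where "filter (\<lambda>x. x = i \<or> x = l) w = i # v"
      using assms initial_iff_filter by blast
    with l show ?thesis by (simp add: filter_remove1)
  next
    case False
    then show ?thesis by (simp add: filter_remove1 remove1_idem)
  qed
qed

lemma lmult_cong: "trace_eq u v \<Longrightarrow> trace_eq (lmult i u) (lmult i v)"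
  using initial_cong[of u v i] by (auto simp: lmult_def trace_eq_def filter_remove1)

text \<open>The generators act as involutions. Irreducibility matters when \<open>i\<close> is
  cancelled: if another \<open>i\<close> became initial, the second multiplication would cancel
  again.\<close>

lemma lmult_lmult: "irreducible w \<Longrightarrow> trace_eq (lmult i (lmult i w)) w"
  by (simp add: lmult_def not_initial_remove1 trace_eq_Cons_remove1)

lemma lmult_commute:
  assumes "comm i j"
  shows "trace_eq (lmult i (lmult j w)) (lmult j (lmult i w))"
proof -
  have neq: "i \<noteq> j" and c: "comm j i" using assms comm_irrefl comm_sym by auto
  have "trace_eq (i # j # w) (j # i # w)"
    using neq assms c by (auto simp: trace_eq_def)
  then show ?thesis
    using assms neq c by (simp add: lmult_def initial_remove1 remove1_commute)
qed

section \<open>Normal forms: the action of words on the empty word\<close>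

definition normal_form :: "'i list \<Rightarrow> 'i list" where
  "normal_form w = foldr lmult w []"

lemma irreducible_foldr_lmult: "irreducible v \<Longrightarrow> irreducible (foldr lmult w v)"
  by (induction w) (auto simp: irreducible_lmult)

lemma foldr_lmult_cong: "trace_eq u v \<Longrightarrow> trace_eq (foldr lmult w u) (foldr lmult w v)"
  by (induction w) (auto simp: lmult_cong)

lemma normal_form_irreducible: "irreducible w \<Longrightarrow> normal_form w = w"
  by (induction w) (auto simp: normal_form_def lmult_def)

lemma length_normal_form: "length (normal_form w) \<le> length w"
proof (induction w)
  case (Cons i w)
  have "length (lmult i v) \<le> Suc (length v)" for v
    by (auto simp: lmult_def length_remove1)
  with Cons show ?case
    by (auto simp: normal_form_def intro: order.trans)
qed (simp add: normal_form_def)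

text \<open>The projection to the pair (\<open>i\<close>, \<open>i\<close>) counts the occurrences
  of \<open>i\<close>.\<close>

lemma trace_eq_length:
  assumes "trace_eq u v"
  shows "length u = length v"
proof -
  have "count_list u i = count_list v i" for i
    using trace_eqD[OF assms comm_irrefl, of i]
    by (simp add: count_list_eq_length_filter flip: fun_eq_iff) (metis (mono_tags, lifting) filter_cong)
  then show ?thesis
    using sum_count_set[of u "set u \<union> set v"] sum_count_set[of v "set u \<union> set v"] by simp
qed

lemma initial_splitE:
  "initial i (map fst q) \<Longrightarrow>
    \<exists>q1 z q2. q = q1 @ (i, z) # q2 \<and> (\<forall>j\<in>set (map fst q1). comm i j)"
proof (induction q)
  case (Cons a q)
  obtain j y where a: "a = (j, y)" by force
  show ?case
  proof (cases "j = i")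
    case True
    then show ?thesis using a by (intro exI[of _ "[]"]) auto
  next
    case False
    with Cons a obtain q1 z q2 where "q = q1 @ (i, z) # q2" "\<forall>j\<in>set (map fst q1). comm i j"
      by auto
    with False Cons.prems a show ?thesis
      by (intro exI[of _ "a # q1"]) auto
  qed
qed simp

end

section \<open>Galleries in right-angled buildings\<close>

text \<open>\<open>T i x z\<close> carries the fibre over \<open>x\<close> to the fibre over
  \<open>z\<close>. Each list entry holds the type of an edge and its far end.\<close>

fun transport :: "('i \<Rightarrow> 'c \<Rightarrow> 'c \<Rightarrow> 'b \<Rightarrow> 'b) \<Rightarrow> 'c \<Rightarrow> ('i \<times> 'c) list \<Rightarrow> 'b \<Rightarrow> 'b" where
  "transport T x [] b = b"
| "transport T x ((i, z) # p) b = transport T z p (T i x z b)"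

locale ra_building =
  fixes D :: "('i, 'c) chamber_system"
    and m :: "'i \<Rightarrow> 'i \<Rightarrow> enat"
    and \<delta> :: "'c \<Rightarrow> 'c \<Rightarrow> 'i list set"
  assumes building: "right_angled_building m D \<delta>"
begin

abbreviation "I \<equiv> index_set D"
abbreviation "C \<equiv> chambers D"

definition comm :: "'i \<Rightarrow> 'i \<Rightarrow> bool" where
  "comm i j \<longleftrightarrow> i \<in> I \<and> j \<in> I \<and> m i j = 2"

lemma m_diag: "i \<in> I \<Longrightarrow> m i i = 1"
  using building
  by (simp add: right_angled_building_def is_building_def coxeter_matrix_def)

lemma m_cases: "i \<in> I \<Longrightarrow> j \<in> I \<Longrightarrow> i \<noteq> j \<Longrightarrow> m i j = 2 \<or> m i j = \<infinity>"
  using building by (simp add: right_angled_building_def right_angled_def)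

sublocale commutation comm
proof
  show "comm j i" if "comm i j" for i j
    using that building
    by (cases "i = j")
      (auto simp: comm_def right_angled_building_def is_building_def coxeter_matrix_def)
  show "\<not> comm i i" for i
    using m_diag[of i] by (auto simp: comm_def)
qed

lemma adj_equiv: "i \<in> I \<Longrightarrow> equiv C (adj D i)"
  using building
  by (auto simp: right_angled_building_def is_building_def is_chamber_system_def)

lemma adj_chambers: "i \<in> I \<Longrightarrow> adj D i \<subseteq> C \<times> C"
  using adj_equiv equiv_type by blast

lemma adj_in: "(x, y) \<in> adj D i \<Longrightarrow> i \<in> I \<Longrightarrow> x \<in> C \<and> y \<in> C"
  using adj_chambers by blast

lemma adj_refl: "i \<in> I \<Longrightarrow> x \<in> C \<Longrightarrow> (x, x) \<in> adj D i"
  using adj_equiv by (metis equivE refl_onD)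

lemma adj_sym: "i \<in> I \<Longrightarrow> (x, y) \<in> adj D i \<Longrightarrow> (y, x) \<in> adj D i"
  using adj_equiv by (metis equivE symD)

lemma adj_trans: "i \<in> I \<Longrightarrow> (x, y) \<in> adj D i \<Longrightarrow> (y, z) \<in> adj D i \<Longrightarrow> (x, z) \<in> adj D i"
  using adj_equiv by (metis equivE transD)

text \<open>Unlike \<open>gallery\<close>, a path remembers its chambers and may stutter, so sliding
  and merging edges always yields a path again.\<close>

fun path :: "'c \<Rightarrow> ('i \<times> 'c) list \<Rightarrow> 'c \<Rightarrow> bool" where
  "path x [] y \<longleftrightarrow> x \<in> C \<and> x = y"
| "path x ((i, z) # p) y \<longleftrightarrow> i \<in> I \<and> (x, z) \<in> adj D i \<and> path z p y"

lemma path_in: "path x p y \<Longrightarrow> x \<in> C \<and> y \<in> C"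
  by (induction x p y rule: path.induct) (auto dest: adj_in)

lemma path_append: "path x (p @ q) y \<longleftrightarrow> (\<exists>z. path x p z \<and> path z q y)"
  by (induction x p y rule: path.induct) (auto dest: path_in)

section \<open>Irreducible words are reduced\<close>

lemma coxeter_rel_lists: "(u, v) \<in> coxeter_rel I m \<Longrightarrow> u \<in> lists I \<and> v \<in> lists I"
  by (induction rule: coxeter_rel.induct) (auto simp: in_lists_conv_set)

lemma coxeter_rel_equiv: "equiv (lists I) (coxeter_rel I m)"
  by (rule equivI)
    (auto intro!: refl_onI symI transI intro: coxeter_rel.intros dest: coxeter_rel_lists)

text \<open>Finite entries of the matrix are 1 on the diagonal and 2 off it, so a relator is either
  a squared generator or the square of a product of two commuting generators.\<close>

lemma foldr_lmult_relator:
  assumes "i \<in> I" "j \<in> I" "m i j = enat n" "irreducible v"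
  shows "trace_eq (foldr lmult (concat (replicate n [i, j])) v) v"
proof (cases "i = j")
  case True
  then have "n = 1" using m_diag assms by (simp add: one_enat_def)
  with True assms(4) show ?thesis by (simp add: lmult_lmult)
next
  case False
  then have "m i j = 2" using m_cases[OF assms(1,2)] assms(3) by auto
  then have c: "comm i j" and n: "n = 2"
    using assms by (auto simp: comm_def numeral_eq_enat)
  let ?i = "lmult i" and ?j = "lmult j"
  have irr: "irreducible (?i v)" "irreducible (?j (?i v))" "irreducible (?j v)"
    using assms(4) by (auto simp: irreducible_lmult)
  have "trace_eq (?i (?j (?i (?j v)))) (?i (?j (?j (?i v))))"
    by (intro lmult_cong lmult_commute c)
  also have "trace_eq \<dots> (?i (?i v))"
    by (intro lmult_cong lmult_lmult irr)
  also have "trace_eq \<dots> v" by (rule lmult_lmult[OF assms(4)])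
  finally show ?thesis by (simp add: n numeral_2_eq_2)
qed

lemma normal_form_coxeter_rel:
  "(u, v) \<in> coxeter_rel I m \<Longrightarrow> trace_eq (normal_form u) (normal_form v)"
proof (induction rule: coxeter_rel.induct)
  case (relator i j n u v)
  then show ?case
    by (simp add: normal_form_def foldr_lmult_cong foldr_lmult_relator irreducible_foldr_lmult)
qed (auto intro: trace_eq_sym trace_eq_trans)

text \<open>Equivalent words have normal forms of equal length, normal forms are never longer than
  the word, and an irreducible word is its own normal form.\<close>

lemma irreducible_reduced:
  assumes "irreducible w" "w \<in> lists I"
  shows "reduced_word I m w"
  unfolding reduced_word_def
proof (intro conjI allI impI)
  fix g assume "(w, g) \<in> coxeter_rel I m"
  then have "length w = length (normal_form g)"
    using normal_form_coxeter_rel trace_eq_length normal_form_irreducible[OF assms(1)] by metis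
  then show "length w \<le> length g" using length_normal_form by simp
qed fact

lemma gallery_delta:
  "reduced_word I m f \<Longrightarrow> x \<in> C \<Longrightarrow> y \<in> C \<Longrightarrow>
    \<delta> x y = coxeter_rel I m `` {f} \<longleftrightarrow> gallery D f x y"
  using building by (auto simp: right_angled_building_def is_building_def)

lemma gallery_in: "gallery D w x y \<Longrightarrow> x \<in> C \<and> y \<in> C \<and> w \<in> lists I"
  by (induction w arbitrary: x) (auto dest: adj_in)

lemma gallery_path: "gallery D w x y \<Longrightarrow> \<exists>p. path x p y \<and> map fst p = w"
proof (induction w arbitrary: x)
  case (Cons i w)
  then obtain z p where "i \<in> I" "(x, z) \<in> adj D i" "path z p y" "map fst p = w"
    by fastforce
  then show ?case by (intro exI[of _ "(i, z) # p"]) auto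
qed auto

lemma irreducible_gallery_delta:
  assumes "irreducible w" "gallery D w x y"
  shows "\<delta> x y = coxeter_rel I m `` {w}"
  using assms gallery_delta gallery_in irreducible_reduced by blast

text \<open>Both types represent \<open>\<delta> x y\<close>, so they are equivalent words and their
  normal forms have the same length.\<close>

lemma irreducible_gallery_length:
  assumes "irreducible v" "irreducible w" "gallery D v x y" "gallery D w x y"
  shows "length v = length w"
proof -
  have "coxeter_rel I m `` {v} = coxeter_rel I m `` {w}"
    using irreducible_gallery_delta[OF assms(1,3)] irreducible_gallery_delta[OF assms(2,4)] by simp
  moreover have "w \<in> coxeter_rel I m `` {w}"
    using coxeter_rel.refl[of w I m] gallery_in[OF assms(4)] by blast
  ultimately have "w \<in> coxeter_rel I m `` {v}" by simp
  then have "(v, w) \<in> coxeter_rel I m" by simp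
  then show ?thesis
    using normal_form_coxeter_rel trace_eq_length normal_form_irreducible assms by metis
qed

lemma connected:
  assumes "x \<in> C" "y \<in> C"
  shows "\<exists>p. path x p y"
proof -
  have "\<delta> x y \<in> coxeter_group I m"
    using building assms by (auto simp: right_angled_building_def is_building_def)
  then obtain f where f: "f \<in> lists I" "\<delta> x y = coxeter_rel I m `` {f}"
    unfolding coxeter_group_def by (rule quotientE)
  \<comment> \<open>Galleries are guaranteed only for reduced types, hence a shortest representative
    of the class.\<close>
  obtain g where g: "(f, g) \<in> coxeter_rel I m"
      "\<And>h. (f, h) \<in> coxeter_rel I m \<Longrightarrow> length g \<le> length h"
    using ex_has_least_nat[of "\<lambda>g. (f, g) \<in> coxeter_rel I m" f length, OF coxeter_rel.refl[OF f(1)]]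
    by blast
  have "reduced_word I m g"
    unfolding reduced_word_def
  proof (intro conjI allI impI)
    show "g \<in> lists I" using coxeter_rel_lists g(1) by blast
    show "length g \<le> length h" if "(g, h) \<in> coxeter_rel I m" for h
      using g(2) coxeter_rel.trans[OF g(1) that] .
  qed
  moreover have "\<delta> x y = coxeter_rel I m `` {g}"
    using f(2) equiv_class_eq[OF coxeter_rel_equiv g(1)] by simp
  ultimately have "gallery D g x y" using gallery_delta assms by blast
  then show ?thesis using gallery_path by blast
qed

section \<open>Commuting squares and flat transport\<close>

lemma square:
  assumes "comm i j" "(x, y) \<in> adj D i" "(y, z) \<in> adj D j"
  shows "\<exists>y'. (x, y') \<in> adj D j \<and> (y', z) \<in> adj D i"
proof -
  have ij: "i \<in> I" "j \<in> I" "i \<noteq> j" "comm j i" "m i j = enat 2" "m j i = enat 2"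
    using assms(1) comm_sym[OF assms(1)] comm_irrefl by (auto simp: comm_def numeral_eq_enat)
  have xyz: "x \<in> C" "y \<in> C" "z \<in> C" using adj_in assms ij by blast+
  consider "x = y" | "y = z" | "x \<noteq> y" "y \<noteq> z" by blast
  then show ?thesis
  proof cases
    case 1
    then show ?thesis using adj_refl assms(3) ij xyz by blast
  next
    case 2
    then show ?thesis using adj_refl assms(2) ij xyz by blast
  next
    case 3
    have irr: "irreducible [i, j]" "irreducible [j, i]" using ij by auto
    have "gallery D [i, j] x z" using 3 assms ij xyz by auto
    then have d: "\<delta> x z = coxeter_rel I m `` {[i, j]}"
      by (rule irreducible_gallery_delta[OF irr(1)])
    have one: "m i i = enat 1" "m j j = enat 1" using m_diag ij by (auto simp: one_enat_def)
    \<comment> \<open>Append the relator \<open>jiji\<close> to \<open>ij\<close>, then cancel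
      \<open>jj\<close> and \<open>ii\<close>; what remains is \<open>ji\<close>. As both words are
      reduced for the same Weyl element, a gallery of one type yields one of the other.\<close>
    have "([i, j, j, i, j, i], [i, j]) \<in> coxeter_rel I m"
      using coxeter_rel.relator[of j I i m 2 "[i, j]" "[]"] ij by (simp add: numeral_2_eq_2)
    moreover have "([i, j, j, i, j, i], [i, i, j, i]) \<in> coxeter_rel I m"
      using coxeter_rel.relator[of j I j m 1 "[i]" "[i, j, i]"] ij one by simp
    moreover have "([i, i, j, i], [j, i]) \<in> coxeter_rel I m"
      using coxeter_rel.relator[of i I i m 1 "[]" "[j, i]"] ij one by simp
    ultimately have "([i, j], [j, i]) \<in> coxeter_rel I m"
      by (meson coxeter_rel.sym coxeter_rel.trans)
    then have "\<delta> x z = coxeter_rel I m `` {[j, i]}"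
      using d equiv_class_eq[OF coxeter_rel_equiv] by blast
    moreover have "reduced_word I m [j, i]" using irreducible_reduced irr ij by simp
    ultimately have "gallery D [j, i] x z" using gallery_delta xyz by blast
    then show ?thesis using ij by auto
  qed
qed

text \<open>A local system on the chambers: no holonomy inside panels or around commuting squares.
  Pairs of types with entry \<infinity> impose no condition, since they contribute no
  relation.\<close>

definition flat :: "('c \<Rightarrow> 'b set) \<Rightarrow> ('i \<Rightarrow> 'c \<Rightarrow> 'c \<Rightarrow> 'b \<Rightarrow> 'b) \<Rightarrow> bool" where
  "flat Fib T \<longleftrightarrow>
     (\<forall>i\<in>I. \<forall>x y b. (x, y) \<in> adj D i \<longrightarrow> b \<in> Fib x \<longrightarrow> T i x y b \<in> Fib y) \<and>
     (\<forall>i\<in>I. \<forall>x\<in>C. \<forall>b\<in>Fib x. T i x x b = b) \<and>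
     (\<forall>i\<in>I. \<forall>x y z b. (x, y) \<in> adj D i \<longrightarrow> (y, z) \<in> adj D i \<longrightarrow> b \<in> Fib x \<longrightarrow>
        T i y z (T i x y b) = T i x z b) \<and>
     (\<forall>i j x y y' z b. comm i j \<longrightarrow> (x, y) \<in> adj D i \<longrightarrow> (y, z) \<in> adj D j \<longrightarrow>
        (x, y') \<in> adj D j \<longrightarrow> (y', z) \<in> adj D i \<longrightarrow> b \<in> Fib x \<longrightarrow>
        T j y z (T i x y b) = T i y' z (T j x y' b))"

lemma flat_mem: "flat Fib T \<Longrightarrow> i \<in> I \<Longrightarrow> (x, y) \<in> adj D i \<Longrightarrow> b \<in> Fib x \<Longrightarrow> T i x y b \<in> Fib y"
  by (simp add: flat_def)

lemma flat_id: "flat Fib T \<Longrightarrow> i \<in> I \<Longrightarrow> x \<in> C \<Longrightarrow> b \<in> Fib x \<Longrightarrow> T i x x b = b"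
  by (simp add: flat_def)

lemma flat_comp: "flat Fib T \<Longrightarrow> i \<in> I \<Longrightarrow> (x, y) \<in> adj D i \<Longrightarrow> (y, z) \<in> adj D i \<Longrightarrow>
    b \<in> Fib x \<Longrightarrow> T i y z (T i x y b) = T i x z b"
  unfolding flat_def by blast

lemma flat_square: "flat Fib T \<Longrightarrow> comm i j \<Longrightarrow> (x, y) \<in> adj D i \<Longrightarrow> (y, z) \<in> adj D j \<Longrightarrow>
    (x, y') \<in> adj D j \<Longrightarrow> (y', z) \<in> adj D i \<Longrightarrow> b \<in> Fib x \<Longrightarrow>
    T j y z (T i x y b) = T i y' z (T j x y' b)"
  unfolding flat_def by blast

lemma transport_mem: "flat Fib T \<Longrightarrow> path x p y \<Longrightarrow> b \<in> Fib x \<Longrightarrow> transport T x p b \<in> Fib y"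
  by (induction x p y arbitrary: b rule: path.induct) (auto simp: flat_mem)

lemma transport_append:
  "path x p z \<Longrightarrow> transport T x (p @ q) b = transport T z q (transport T x p b)"
  by (induction x p z arbitrary: b rule: path.induct) auto

text \<open>Each commuting square moves the \<open>i\<close>-edge one place to the right; the
  squares stacked along \<open>q\<close> move it to the end. Flatness on each square preserves the
  transport.\<close>

lemma shift_edge:
  assumes "flat Fib T" "i \<in> I" "(x, z) \<in> adj D i" "path z q y" "\<forall>j\<in>set (map fst q). comm i j"
  shows "\<exists>q' y'. path x q' y' \<and> (y', y) \<in> adj D i \<and> map fst q' = map fst q \<and>
     (\<forall>b\<in>Fib x. T i y' y (transport T x q' b) = transport T z q (T i x z b))"
  using assms(3-)
proof (induction q arbitrary: x z)
  case Nil
  then show ?case using adj_in[OF Nil(1) assms(2)] by (intro exI[of _ "[]"] exI[of _ x]) auto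
next
  case (Cons a q)
  obtain j u where a: "a = (j, u)" by force
  with Cons.prems have c: "comm i j" "(z, u) \<in> adj D j" "path u q y" "j \<in> I" by auto
  obtain v where v: "(x, v) \<in> adj D j" "(v, u) \<in> adj D i"
    using square[OF c(1) Cons.prems(1) c(2)] by blast
  obtain q' y' where q': "path v q' y'" "(y', y) \<in> adj D i" "map fst q' = map fst q"
     "\<forall>b\<in>Fib v. T i y' y (transport T v q' b) = transport T u q (T i v u b)"
    using Cons.IH[OF v(2) c(3)] Cons.prems(3) by auto
  have "T i y' y (transport T x ((j, v) # q') b) = transport T z ((j, u) # q) (T i x z b)"
    if b: "b \<in> Fib x" for b
    using q'(4) flat_mem[OF assms(1) c(4) v(1) b]
      flat_square[OF assms(1) c(1) Cons.prems(1) c(2) v b] by simp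
  with q' v c a show ?case by (intro exI[of _ "(j, v) # q'"] exI[of _ y']) auto
qed

text \<open>Contracts a path without changing its transport: the tail is tightened first, and the
  leading edge is then dropped if it stutters, kept if no equal type is initial in the tail, or else
  merged with the initial edge of its type.\<close>

lemma tighten:
  assumes "flat Fib T" "path x p y"
  shows "\<exists>q. path x q y \<and> gallery D (map fst q) x y \<and> irreducible (map fst q) \<and>
     length q \<le> length p \<and> set (map fst q) \<subseteq> set (map fst p) \<and>
     (\<forall>b\<in>Fib x. transport T x q b = transport T x p b)"
  using assms(2)
proof (induction "length p" arbitrary: p x rule: less_induct)
  case less
  show ?case
  proof (cases p)
    case Nil
    then show ?thesis using less.prems by (intro exI[of _ "[]"]) auto
  next
    case (Cons a r)
    obtain i z where a: "a = (i, z)" by force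
    with Cons less.prems have iz: "i \<in> I" "(x, z) \<in> adj D i" "path z r y" by auto
    obtain q where q: "path z q y" "gallery D (map fst q) z y" "irreducible (map fst q)"
      "length q \<le> length r" "set (map fst q) \<subseteq> set (map fst r)"
      "\<forall>b\<in>Fib z. transport T z q b = transport T z r b"
      using less.hyps[OF _ iz(3)] Cons by auto
    have tr: "transport T x p b = transport T z q (T i x z b)" if "b \<in> Fib x" for b
      using q(6) flat_mem[OF assms(1) iz(1,2) that] Cons a by simp
    consider "x = z" | "x \<noteq> z" "\<not> initial i (map fst q)" | "initial i (map fst q)" by blast
    then show ?thesis
    proof cases
      case 1
      with q tr flat_id[OF assms(1) iz(1)] adj_in[OF iz(2,1)] Cons show ?thesis
        by (intro exI[of _ q]) auto
    next
      case 2
      with q tr iz Cons a show ?thesis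
        by (intro exI[of _ "(i, z) # q"]) auto
    next
      case 3
      then obtain q1 u q2 where s: "q = q1 @ (i, u) # q2" "\<forall>j\<in>set (map fst q1). comm i j"
        using initial_splitE by blast
      then obtain w where w: "path z q1 w" "(w, u) \<in> adj D i" "path u q2 y"
        using q(1) by (auto simp: path_append)
      obtain q1' w' where q1': "path x q1' w'" "(w', w) \<in> adj D i" "map fst q1' = map fst q1"
        "\<forall>b\<in>Fib x. T i w' w (transport T x q1' b) = transport T z q1 (T i x z b)"
        using shift_edge[OF assms(1) iz(1,2) w(1) s(2)] by blast
      \<comment> \<open>The leading \<open>i\<close>-edge, slid past \<open>q1\<close>, ends at
        \<open>w\<close>, where the second \<open>i\<close>-edge starts. Both lie in one panel and
        become the single edge from \<open>w'\<close> to \<open>u\<close>. This edge may stutter, so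
        the induction hypothesis is applied to \<open>p'\<close> once more.\<close>
      define p' where "p' = q1' @ (i, u) # q2"
      have w'u: "(w', u) \<in> adj D i" using adj_trans iz q1' w by blast
      have p': "path x p' y" using q1'(1) w'u w(3) iz by (auto simp: p'_def path_append)
      have len1: "length q1' = length q1" using q1'(3) by (metis length_map)
      then have len: "length p' < length p" using q(4) Cons s(1) by (simp add: p'_def)
      have sub: "set (map fst p') \<subseteq> set (map fst p)"
      proof -
        have "map fst p' = map fst q" using q1'(3) s(1) by (simp add: p'_def)
        then show ?thesis using q(5) Cons by auto
      qed
      have "transport T x p' b = transport T x p b" if b: "b \<in> Fib x" for b
      proof -
        have "transport T x p' b = transport T u q2 (T i w' u (transport T x q1' b))"
          using transport_append[OF q1'(1), where T = T] by (simp add: p'_def)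
        also have "T i w' u (transport T x q1' b) = T i w u (T i w' w (transport T x q1' b))"
          using flat_comp[OF assms(1) iz(1) q1'(2) w(2) transport_mem[OF assms(1) q1'(1) b]] by simp
        also have "transport T u q2 \<dots> = transport T z q (T i x z b)"
          using q1'(4) b transport_append[OF w(1), where T = T] by (simp add: s(1))
        finally show ?thesis using tr b by simp
      qed
      moreover obtain q' where "path x q' y" "gallery D (map fst q') x y"
        "irreducible (map fst q')" "length q' \<le> length p'" "set (map fst q') \<subseteq> set (map fst p')"
        "\<forall>b\<in>Fib x. transport T x q' b = transport T x p' b"
        using less.hyps[OF len p'] by blast
      ultimately show ?thesis using len sub by (intro exI[of _ q']) auto
    qed
  qed
qed

text \<open>A closed path tightens to an irreducible closed gallery, which must have the length of
  the empty one.\<close>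

lemma transport_closed:
  assumes "flat Fib T" "path x p x" "b \<in> Fib x"
  shows "transport T x p b = b"
proof -
  obtain q where q: "gallery D (map fst q) x x" "irreducible (map fst q)"
      "\<forall>b\<in>Fib x. transport T x q b = transport T x p b"
    using tighten[OF assms(1,2)] by blast
  have "length (map fst q) = length ([] :: 'i list)"
    using irreducible_gallery_length[OF q(2) _ q(1), of "[]"] path_in[OF assms(2)] by simp
  then have "q = []" by simp
  with q(3) assms(3) show ?thesis by auto
qed

lemma path_rev:
  assumes "flat Fib T" "path x p y"
  shows "\<exists>q. path y q x \<and> (\<forall>b\<in>Fib x. transport T y q (transport T x p b) = b)"
  using assms(2)
proof (induction p arbitrary: x)
  case Nil
  then show ?case by (intro exI[of _ "[]"]) auto
next
  case (Cons a p)
  obtain i z where a: "a = (i, z)" by force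
  with Cons.prems have iz: "i \<in> I" "(x, z) \<in> adj D i" "path z p y" by auto
  obtain q where q: "path y q z" "\<forall>b\<in>Fib z. transport T y q (transport T z p b) = b"
    using Cons.IH[OF iz(3)] by blast
  have zx: "(z, x) \<in> adj D i" and x: "x \<in> C" using adj_sym adj_in iz by blast+
  have "transport T y (q @ [(i, x)]) (transport T x (a # p) b) = b" if b: "b \<in> Fib x" for b
    using transport_append[OF q(1), where T = T] q(2) flat_mem[OF assms(1) iz(1,2) b] a
      flat_comp[OF assms(1) iz(1,2) zx b] flat_id[OF assms(1) iz(1) x b] by simp
  moreover have "path y (q @ [(i, x)]) x"
    using q(1) zx x iz by (auto simp: path_append)
  ultimately show ?case by blast
qed

text \<open>Buildings are simply connected: flat transport has no monodromy.\<close>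

theorem flat_section:
  assumes "flat Fib T" "c \<in> C" "b \<in> Fib c"
  shows "\<exists>s. s c = b \<and> (\<forall>x\<in>C. s x \<in> Fib x) \<and>
    (\<forall>i\<in>I. \<forall>x y. (x, y) \<in> adj D i \<longrightarrow> s y = T i x y (s x))"
proof -
  \<comment> \<open>The path is chosen arbitrarily; two choices differ by a closed path, which
    transports trivially.\<close>
  define s where "s x = transport T c (SOME p. path c p x) b" for x
  have s: "s x = transport T c p b" if p: "path c p x" for x p
  proof -
    define r where "r = (SOME p. path c p x)"
    have r: "path c r x" using someI[of "\<lambda>p. path c p x"] p by (simp add: r_def)
    obtain q where q: "path x q c" "\<forall>b\<in>Fib c. transport T x q (transport T c p b) = b"
      using path_rev[OF assms(1) p] by blast
    have xx: "path x (q @ r) x" using q r by (auto simp: path_append)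
    have "transport T x (q @ r) (transport T c p b) = transport T c p b"
      by (intro transport_closed[OF assms(1) xx] transport_mem[OF assms(1) p assms(3)])
    then show ?thesis
      using q assms(3) transport_append[OF q(1), where T = T] by (simp add: s_def r_def)
  qed
  have "s x \<in> Fib x" if x: "x \<in> C" for x
  proof -
    obtain p where p: "path c p x" using connected[OF assms(2) x] by blast
    show ?thesis unfolding s[OF p] by (rule transport_mem[OF assms(1) p assms(3)])
  qed
  moreover have "s y = T i x y (s x)" if "i \<in> I" "(x, y) \<in> adj D i" for i x y
  proof -
    have xy: "x \<in> C" "y \<in> C" using adj_in that by blast+
    obtain p where p: "path c p x" using connected[OF assms(2) xy(1)] by blast
    moreover from p have "path c (p @ [(i, y)]) y" using that xy by (auto simp: path_append)
    ultimately show ?thesis using s transport_append[OF p, where T = T] by simp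
  qed
  moreover have "s c = b" using s[of "[]" c] assms(2) by simp
  ultimately show ?thesis by blast
qed

section \<open>Induction along paths, and gallery distance\<close>

lemma path_invariant:
  assumes "path x p y"
    and "\<And>i u v. i \<in> set (map fst p) \<Longrightarrow> i \<in> I \<Longrightarrow> (u, v) \<in> adj D i \<Longrightarrow> Q u \<Longrightarrow> Q v"
    and "Q x"
  shows "Q y"
  using assms
proof (induction p arbitrary: x)
  case (Cons a p)
  obtain i z where a: "a = (i, z)" by force
  with Cons.prems(1) have iz: "i \<in> I" "(x, z) \<in> adj D i" "path z p y" by auto
  have "Q z" by (rule Cons.prems(2)[OF _ iz(1,2) Cons.prems(3)]) (simp add: a)
  moreover have "Q v" if "j \<in> set (map fst p)" "j \<in> I" "(u, v) \<in> adj D j" "Q u" for j u v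
    by (rule Cons.prems(2)[OF _ that(2-4)]) (use that(1) in simp)
  ultimately show ?case by (rule Cons.IH[OF iz(3) _, rotated -1])
qed auto

lemma chambers_induct [consumes 2, case_names base step]:
  assumes "c \<in> C" "x \<in> C" "Q c"
    and "\<And>i u v. i \<in> I \<Longrightarrow> (u, v) \<in> adj D i \<Longrightarrow> Q u \<Longrightarrow> Q v"
  shows "Q x"
proof -
  obtain p where p: "path c p x" using connected[OF assms(1,2)] by blast
  show ?thesis by (rule path_invariant[where Q = Q, OF p _ assms(3)]) (rule assms(4))
qed

lemma irreducible_gallery_dist:
  assumes "irreducible w" "gallery D w x y"
  shows "gallery_dist D x y = length w"
  unfolding gallery_dist_def
proof (rule Least_equality)
  fix n assume "\<exists>v. length v = n \<and> gallery D v x y"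
  then obtain p where p: "path x p y" "length p = n" using gallery_path by (metis length_map)
  \<comment> \<open>One-point fibres reduce \<open>tighten\<close> to its statement about lengths
    and types.\<close>
  have "flat (\<lambda>_. UNIV) (\<lambda>_ _ _ b. b :: unit)" by (simp add: flat_def)
  from tighten[OF this p(1)] p(2) obtain q :: "('i \<times> 'c) list" where "gallery D (map fst q) x y"
    "irreducible (map fst q)" "length q \<le> n" by auto
  then show "length w \<le> n" using irreducible_gallery_length[OF assms(1) _ assms(2)] by fastforce
qed (use assms in auto)

lemma irreducible_gallery_exists:
  assumes "path x p y"
  shows "\<exists>w. irreducible w \<and> gallery D w x y \<and> length w \<le> length p \<and> set w \<subseteq> set (map fst p)"
proof -
  have "flat (\<lambda>_. UNIV) (\<lambda>_ _ _ b. b :: unit)" by (simp add: flat_def)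
  from tighten[OF this assms] obtain q :: "('i \<times> 'c) list" where "gallery D (map fst q) x y"
    "irreducible (map fst q)" "length q \<le> length p" "set (map fst q) \<subseteq> set (map fst p)" by auto
  then show ?thesis by (intro exI[of _ "map fst q"]) auto
qed

lemma gallery_dist_le: "path x p y \<Longrightarrow> gallery_dist D x y \<le> length p"
  using irreducible_gallery_exists irreducible_gallery_dist by metis

end

section \<open>Walls\<close>

context ra_building
begin

lemma gallery_panel: "gallery D w x y \<Longrightarrow> w \<in> lists {i} \<Longrightarrow> i \<in> I \<Longrightarrow> (x, y) \<in> adj D i"
proof (induction w arbitrary: x)
  case (Cons j w)
  from Cons.prems(1,2) obtain z
    where z: "(x, z) \<in> adj D i" "gallery D w z y" "w \<in> lists {i}" by auto
  show ?case using adj_trans[OF Cons.prems(3) z(1) Cons.IH[OF z(2,3) Cons.prems(3)]] .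
qed (simp add: adj_refl)

lemma residue_singleton:
  assumes "i \<in> I" "x \<in> C"
  shows "residue D {i} x = adj D i `` {x}"
proof
  show "residue D {i} x \<subseteq> adj D i `` {x}"
  proof
    fix y assume "y \<in> residue D {i} x"
    then obtain w where w: "w \<in> lists {i}" "gallery D w x y"
      unfolding residue_def mem_Collect_eq by (rule bexE)
    show "y \<in> adj D i `` {x}" using gallery_panel[OF w(2,1) assms(1)] by simp
  qed
  show "adj D i `` {x} \<subseteq> residue D {i} x"
  proof
    fix y assume "y \<in> adj D i `` {x}"
    then have xy: "(x, y) \<in> adj D i" by simp
    then have y: "y \<in> C" using adj_in assms by blast
    show "y \<in> residue D {i} x"
    proof (cases "x = y")
      case True
      then have "gallery D [] x y" using assms by simp
      then show ?thesis unfolding residue_def mem_Collect_eq by (rule bexI) (use assms in simp)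
    next
      case False
      with xy y assms have "gallery D [i] x y" by auto
      then show ?thesis unfolding residue_def mem_Collect_eq by (rule bexI) (use assms in simp)
    qed
  qed
qed

lemma panels_eq: "i \<in> I \<Longrightarrow> panels D i = (\<lambda>x. adj D i `` {x}) ` C"
  unfolding panels_def by (intro image_cong residue_singleton) auto

lemma panel_eqI: "i \<in> I \<Longrightarrow> (x, y) \<in> adj D i \<Longrightarrow> adj D i `` {x} = adj D i `` {y}"
  using equiv_class_eq[OF adj_equiv] .

text \<open>The union of the panels parallel to the \<open>i\<close>-panel of \<open>x\<close>.\<close>

definition wall :: "'i \<Rightarrow> 'c \<Rightarrow> 'c set" where
  "wall i x = {y. \<exists>p. path x p y \<and> (\<forall>j\<in>set (map fst p). j = i \<or> comm i j)}"

lemma wallI: "path x p y \<Longrightarrow> \<forall>j\<in>set (map fst p). j = i \<or> comm i j \<Longrightarrow> y \<in> wall i x"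
  unfolding wall_def by blast

lemma wall_in: "y \<in> wall i x \<Longrightarrow> x \<in> C \<and> y \<in> C"
  unfolding wall_def using path_in by blast

lemma wall_refl: "x \<in> C \<Longrightarrow> x \<in> wall i x"
  by (rule wallI[of _ "[]"]) simp_all

lemma wall_trans: "y \<in> wall i x \<Longrightarrow> z \<in> wall i y \<Longrightarrow> z \<in> wall i x"
proof -
  assume "y \<in> wall i x" "z \<in> wall i y"
  then obtain p q where "path x p y" "\<forall>j\<in>set (map fst p). j = i \<or> comm i j"
    "path y q z" "\<forall>j\<in>set (map fst q). j = i \<or> comm i j"
    by (auto simp: wall_def)
  then show ?thesis
    by (intro wallI[of _ "p @ q"]) (auto simp: path_append)
qed

lemma wall_adj:
  assumes "j \<in> I" "(x, y) \<in> adj D j" "j = i \<or> comm i j"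
  shows "y \<in> wall i x"
  using assms adj_in[OF assms(2,1)]
  by (intro wallI[of _ "[(j, y)]"]) auto

lemma wall_sym:
  assumes "y \<in> wall i x"
  shows "x \<in> wall i y"
proof -
  from assms obtain p where p: "path x p y" "\<forall>j\<in>set (map fst p). j = i \<or> comm i j"
    by (auto simp: wall_def)
  show ?thesis
  proof (rule path_invariant[where Q = "\<lambda>z. x \<in> wall i z", OF p(1)])
    show "x \<in> wall i v"
      if "j \<in> set (map fst p)" "j \<in> I" "(u, v) \<in> adj D j" "x \<in> wall i u" for j u v
      using wall_trans[OF wall_adj[OF that(2) adj_sym[OF that(2,3)]] that(4)] p(2) that(1) by blast
    show "x \<in> wall i x" using wall_refl path_in[OF p(1)] by blast
  qed
qed

lemma wall_adj_iff:
  "j \<in> I \<Longrightarrow> (y, z) \<in> adj D j \<Longrightarrow> j = i \<or> comm i j \<Longrightarrow> y \<in> wall i x \<longleftrightarrow> z \<in> wall i x"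
  using wall_adj[of j y z i] wall_sym[of z i y] wall_trans[of y i x z] wall_trans[of z i x y] by blast

lemma wall_invariant:
  assumes "y \<in> wall i x" "Q x"
    and "\<And>j u v. j = i \<or> comm i j \<Longrightarrow> j \<in> I \<Longrightarrow> (u, v) \<in> adj D j \<Longrightarrow>
      u \<in> wall i x \<Longrightarrow> v \<in> wall i x \<Longrightarrow> Q u \<Longrightarrow> Q v"
  shows "Q y"
proof -
  from assms(1) obtain p where p: "path x p y" "\<forall>j\<in>set (map fst p). j = i \<or> comm i j"
    by (auto simp: wall_def)
  have "y \<in> wall i x \<and> Q y"
  proof (rule path_invariant[where Q = "\<lambda>z. z \<in> wall i x \<and> Q z", OF p(1)])
    show "v \<in> wall i x \<and> Q v" if "j \<in> set (map fst p)" "j \<in> I" "(u, v) \<in> adj D j"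
      "u \<in> wall i x \<and> Q u" for j u v
      using assms(3)[OF _ that(2,3)] wall_adj_iff[OF that(2,3)] p(2) that(1,4) by blast
    show "x \<in> wall i x \<and> Q x" using wall_refl path_in[OF p(1)] assms(2) by blast
  qed
  then show ?thesis ..
qed

lemma panel_nontrivial:
  assumes "l \<in> I" "y \<in> C"
  shows "\<exists>z. (y, z) \<in> adj D l \<and> y \<noteq> z"
proof -
  have "adj D l `` {y} \<in> panels D l" using assms by (auto simp: panels_eq)
  moreover have "\<forall>P\<in>panels D l. \<exists>u\<in>P. \<exists>v\<in>P. u \<noteq> v"
    using building assms(1) by (simp add: right_angled_building_def is_building_def)
  ultimately obtain u v where "u \<in> adj D l `` {y}" "v \<in> adj D l `` {y}" "u \<noteq> v" by blast
  then show ?thesis by (cases "u = y") auto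
qed

text \<open>The alternating words in \<open>j\<close> and \<open>k\<close> are irreducible because
  these letters do not commute. Galleries of these types from \<open>x\<close> stay in the wall and
  end at distance exactly \<open>n\<close> from \<open>x\<close>, so their ends are pairwise
  distinct.\<close>

lemma infinite_wall:
  assumes "comm i j" "comm i k" "m j k = \<infinity>" "x \<in> C"
  shows "infinite (wall i x)"
proof -
  have jk: "i \<in> I" "j \<in> I" "k \<in> I" "\<not> comm j k" "\<not> comm k j"
    using assms(1-3) comm_sym by (auto simp: comm_def)
  have neq: "j \<noteq> k" using assms(3) m_diag[OF jk(2)] by auto
  define alt where "alt l n = map (\<lambda>r. if even r then l else if l = j then k else j) [0..<n]"
    for l and n :: nat
  have alt_Suc: "alt j (Suc n) = j # alt k n" "alt k (Suc n) = k # alt j n" for n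
    using neq by (auto simp: alt_def map_upt_Suc simp del: upt_Suc)
  have no_initial: "\<not> initial j (alt k n)" "\<not> initial k (alt j n)" for n
    using neq jk by (cases n; auto simp: alt_Suc alt_def[of _ 0])+
  have irr: "irreducible (alt j n) \<and> irreducible (alt k n)" for n
    by (induction n) (auto simp: alt_Suc no_initial alt_def[of _ 0])
  have ex: "\<exists>y. gallery D w x y" if "set w \<subseteq> I" "x \<in> C" for w x
    using that
  proof (induction w arbitrary: x)
    case (Cons l w)
    then obtain z where z: "(x, z) \<in> adj D l" "x \<noteq> z" using panel_nontrivial[of l x] by auto
    have l: "l \<in> I" "set w \<subseteq> I" using Cons.prems by auto
    then have "z \<in> C" using adj_in[OF z(1)] by blast
    then obtain y where "gallery D w z y" using Cons.IH[OF l(2)] by blast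
    with z Cons.prems show ?case by auto
  qed auto
  have "set (alt j n) \<subseteq> I" for n using jk by (auto simp: alt_def)
  then have "\<forall>n. \<exists>y. gallery D (alt j n) x y" using ex assms(4) by blast
  then obtain y where y: "\<And>n. gallery D (alt j n) x (y n)" by metis
  have "gallery_dist D x (y n) = n" for n
    using irreducible_gallery_dist[OF _ y[of n]] irr by (simp add: alt_def)
  then have "inj y" by (metis injI)
  moreover have "y n \<in> wall i x" for n
  proof -
    obtain p where p: "path x p (y n)" "map fst p = alt j n" using gallery_path[OF y] by blast
    have "set (alt j n) \<subseteq> {j, k}" by (auto simp: alt_def)
    then have "\<forall>l\<in>set (map fst p). l = i \<or> comm i l" using p(2) assms(1,2) by auto
    then show ?thesis using p(1) unfolding wall_def by blast
  qed
  ultimately show ?thesis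
    using infinite_super[of "range y" "wall i x"] range_inj_infinite by blast
qed

end

section \<open>Legal colorings and automorphisms\<close>

locale colored_building = ra_building D m \<delta>
  for D :: "('i, 'c) chamber_system" and m \<delta> +
  fixes \<Omega> :: "'i \<Rightarrow> 'o set" and lam :: "'i \<Rightarrow> 'c \<Rightarrow> 'o"
  assumes coloring: "legal_coloring D \<Omega> lam"
begin

lemma color_in: "i \<in> I \<Longrightarrow> x \<in> C \<Longrightarrow> lam i x \<in> \<Omega> i"
  using coloring by (auto simp: legal_coloring_def)

lemma color_bij: "i \<in> I \<Longrightarrow> x \<in> C \<Longrightarrow> bij_betw (lam i) (adj D i `` {x}) (\<Omega> i)"
  using coloring by (auto simp: legal_coloring_def panels_eq)

lemma color_adj:
  assumes "i \<in> I" "j \<in> I" "j \<noteq> i" "(x, y) \<in> adj D i"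
  shows "lam j x = lam j y"
proof -
  have "x \<in> C" using adj_in assms by blast
  then have "adj D i `` {x} \<in> panels D i" "x \<in> adj D i `` {x}" "y \<in> adj D i `` {x}"
    using assms adj_refl by (auto simp: panels_eq)
  then show ?thesis using coloring assms unfolding legal_coloring_def by blast
qed

lemma color_inj: "i \<in> I \<Longrightarrow> (x, y) \<in> adj D i \<Longrightarrow> lam i x = lam i y \<Longrightarrow> x = y"
  using color_bij[of i x] adj_in[of x y i] adj_refl[of i x]
  by (auto simp: bij_betw_def inj_on_def)

text \<open>The coloring identifies each \<open>i\<close>-panel with \<open>\<Omega> i\<close>; this
  is the inverse identification, the elementary move when chambers are located by their
  colors.\<close>

definition step :: "'i \<Rightarrow> 'o \<Rightarrow> 'c \<Rightarrow> 'c" where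
  "step i a x = inv_into (adj D i `` {x}) (lam i) a"

lemma step:
  assumes "i \<in> I" "x \<in> C" "a \<in> \<Omega> i"
  shows step_adj: "(x, step i a x) \<in> adj D i" and step_color: "lam i (step i a x) = a"
    and step_in: "step i a x \<in> C"
proof -
  have "a \<in> lam i ` (adj D i `` {x})" using color_bij assms by (simp add: bij_betw_def)
  from inv_into_into[OF this] f_inv_into_f[OF this]
  show "(x, step i a x) \<in> adj D i" "lam i (step i a x) = a" by (auto simp: step_def)
  then show "step i a x \<in> C" using adj_in assms by blast
qed

lemma step_unique:
  assumes "i \<in> I" "(x, y) \<in> adj D i"
  shows "step i (lam i y) x = y"
proof -
  have xy: "x \<in> C" "y \<in> C" using adj_in assms by blast+
  have "(step i (lam i y) x, y) \<in> adj D i"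
    using step_adj[OF assms(1) xy(1) color_in[OF assms(1) xy(2)]] assms adj_sym adj_trans by blast
  then show ?thesis
    using color_inj[OF assms(1)] step_color[OF assms(1) xy(1) color_in[OF assms(1) xy(2)]] by blast
qed

section \<open>Automorphisms from pairs of legal colorings\<close>

lemma coloring_section:
  assumes "legal_coloring D \<Omega> mu" "c \<in> C" "c' \<in> C" "\<And>k. k \<in> I \<Longrightarrow> lam k c' = mu k c"
  obtains s where "s c = c'" "\<And>x. x \<in> C \<Longrightarrow> s x \<in> C"
    "\<And>x k. x \<in> C \<Longrightarrow> k \<in> I \<Longrightarrow> lam k (s x) = mu k x"
    "\<And>i x y. i \<in> I \<Longrightarrow> (x, y) \<in> adj D i \<Longrightarrow> (s x, s y) \<in> adj D i"
proof -
  interpret mu: colored_building D m \<delta> \<Omega> mu by unfold_locales fact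
  \<comment> \<open>A section of this local system is a map that turns \<open>mu\<close> into
    \<open>lam\<close>. Along an \<open>i\<close>-edge only the \<open>i\<close>-color may change,
    so the transported chamber is determined by its new \<open>i\<close>-color within its
    \<open>i\<close>-panel.\<close>
  define Fib where "Fib x = {y \<in> C. \<forall>k\<in>I. lam k y = mu k x}" for x
  define T where "T i x x' y = step i (mu i x') y" for i and x x' y :: 'c
  have T: "(y, T i x x' y) \<in> adj D i" "lam i (T i x x' y) = mu i x'" "T i x x' y \<in> Fib x'"
    if asm: "i \<in> I" "(x, x') \<in> adj D i" "y \<in> Fib x" for i x x' y
  proof -
    have in_C: "x \<in> C" "x' \<in> C" "y \<in> C" using adj_in asm by (auto simp: Fib_def)
    have a: "mu i x' \<in> \<Omega> i" using mu.color_in asm in_C by blast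
    show 1: "(y, T i x x' y) \<in> adj D i" and 2: "lam i (T i x x' y) = mu i x'"
      using step_adj[OF asm(1) in_C(3) a] step_color[OF asm(1) in_C(3) a] by (simp_all add: T_def)
    have "lam k (T i x x' y) = mu k x'" if k: "k \<in> I" for k
    proof (cases "k = i")
      case False
      have "lam k (T i x x' y) = lam k y" using color_adj[OF asm(1) k False 1] by simp
      also have "\<dots> = mu k x" using asm(3) k by (simp add: Fib_def)
      also have "\<dots> = mu k x'" by (rule mu.color_adj[OF asm(1) k False asm(2)])
      finally show ?thesis .
    qed (simp add: 2)
    moreover have "T i x x' y \<in> C" using adj_in[OF 1] asm by blast
    ultimately show "T i x x' y \<in> Fib x'" by (simp add: Fib_def)
  qed
  have T_eq: "T i x x' y = z" if "i \<in> I" "(y, z) \<in> adj D i" "lam i z = mu i x'" for i x x' y z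
    using step_unique[OF that(1,2)] that(3) by (simp add: T_def)
  have flat: "flat Fib T"
    unfolding flat_def
  proof (intro conjI ballI allI impI)
    show "T i x y b \<in> Fib y" if "i \<in> I" "(x, y) \<in> adj D i" "b \<in> Fib x" for i x y b
      using T(3)[OF that] .
    show "T i x x b = b" if "i \<in> I" "x \<in> C" "b \<in> Fib x" for i x b
    proof (rule T_eq[OF that(1)])
      show "(b, b) \<in> adj D i" "lam i b = mu i x"
        using that adj_refl by (auto simp: Fib_def)
    qed
    show "T i y z (T i x y b) = T i x z b"
      if "i \<in> I" "(x, y) \<in> adj D i" "(y, z) \<in> adj D i" "b \<in> Fib x" for i x y z b
    proof -
      have xz: "(x, z) \<in> adj D i" using adj_trans that by blast
      have "(T i x y b, T i x z b) \<in> adj D i"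
        using adj_trans[OF that(1) adj_sym[OF that(1) T(1)[OF that(1,2,4)]] T(1)[OF that(1) xz that(4)]] .
      then show ?thesis using T_eq[OF that(1)] T(2)[OF that(1) xz that(4)] by simp
    qed
    show "T j y z (T i x y b) = T i y' z (T j x y' b)"
      if c: "comm i j" and xy: "(x, y) \<in> adj D i" and yz: "(y, z) \<in> adj D j"
        and xy': "(x, y') \<in> adj D j" and y'z: "(y', z) \<in> adj D i" and b: "b \<in> Fib x"
      for i j x y y' z b
    proof -
      have ij: "i \<in> I" "j \<in> I" "i \<noteq> j" using c comm_irrefl by (auto simp: comm_def)
      note Txy = T[OF ij(1) xy b]
      note Tyz = T[OF ij(2) yz Txy(3)]
      obtain u where u: "(b, u) \<in> adj D j" "(u, T j y z (T i x y b)) \<in> adj D i"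
        using square[OF c Txy(1) Tyz(1)] by (elim exE conjE)
      \<comment> \<open>Moving in an \<open>i\<close>-panel does not affect the
        \<open>j\<close>-color, so the corner \<open>u\<close> of the square has the color that
        characterizes the transport along the other side.\<close>
      have "lam j u = lam j (T j y z (T i x y b))" using color_adj[OF ij(1,2) _ u(2)] ij(3) by simp
      also have "\<dots> = mu j y'" using Tyz(2) mu.color_adj[OF ij(1,2) _ y'z] ij(3) by simp
      finally have "T j x y' b = u" by (rule T_eq[OF ij(2) u(1)])
      moreover have "lam i (T j y z (T i x y b)) = mu i z"
        using Tyz(3) ij by (simp add: Fib_def)
      ultimately show ?thesis using T_eq[OF ij(1) u(2), of z] by simp
    qed
  qed
  have "c' \<in> Fib c" using assms by (simp add: Fib_def)
  then obtain s where s: "s c = c'" "\<forall>x\<in>C. s x \<in> Fib x"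
    "\<forall>i\<in>I. \<forall>x y. (x, y) \<in> adj D i \<longrightarrow> s y = T i x y (s x)"
    using flat_section[OF flat assms(2)] by metis
  show ?thesis
  proof (rule that[of s])
    show "s x \<in> C" if "x \<in> C" for x using s(2) that by (auto simp: Fib_def)
    show "s c = c'" by (rule s(1))
    show "lam k (s x) = mu k x" if "x \<in> C" "k \<in> I" for x k using s(2) that by (auto simp: Fib_def)
    show "(s x, s y) \<in> adj D i" if "i \<in> I" "(x, y) \<in> adj D i" for i x y
    proof -
      have "s x \<in> Fib x" using s(2) adj_in[OF that(2,1)] by blast
      then show ?thesis using T(1)[OF that] s(3) that by metis
    qed
  qed
qed

text \<open>Sections for (\<open>lam\<close>, \<open>mu\<close>) and (\<open>mu\<close>,
  \<open>lam\<close>) with matching base points are mutually inverse: a composite preserves colors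
  and adjacency and fixes the base point, and within a panel a chamber is known by its
  color.\<close>

theorem colored_automorphism:
  assumes "legal_coloring D \<Omega> mu" "c \<in> C" "c' \<in> C" "\<And>k. k \<in> I \<Longrightarrow> lam k c' = mu k c"
  obtains g where "g \<in> aut D" "g c = c'" "\<And>x k. x \<in> C \<Longrightarrow> k \<in> I \<Longrightarrow> lam k (g x) = mu k x"
proof -
  interpret mu: colored_building D m \<delta> \<Omega> mu by unfold_locales fact
  obtain s where s: "s c = c'" "\<And>x. x \<in> C \<Longrightarrow> s x \<in> C"
    "\<And>x k. x \<in> C \<Longrightarrow> k \<in> I \<Longrightarrow> lam k (s x) = mu k x"
    "\<And>i x y. i \<in> I \<Longrightarrow> (x, y) \<in> adj D i \<Longrightarrow> (s x, s y) \<in> adj D i"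
    using coloring_section[OF assms] by blast
  obtain t where t: "t c' = c" "\<And>x. x \<in> C \<Longrightarrow> t x \<in> C"
    "\<And>x k. x \<in> C \<Longrightarrow> k \<in> I \<Longrightarrow> mu k (t x) = lam k x"
    "\<And>i x y. i \<in> I \<Longrightarrow> (x, y) \<in> adj D i \<Longrightarrow> (t x, t y) \<in> adj D i"
    using mu.coloring_section[OF coloring assms(3,2)] assms(4) by metis
  have ts: "t (s x) = x" if "x \<in> C" for x
    using assms(2) that
  proof (induction rule: chambers_induct)
    case (step i u v)
    have uv: "u \<in> C" "v \<in> C" using adj_in step by blast+
    have "(v, t (s v)) \<in> adj D i"
      using t(4)[OF step(1) s(4)[OF step(1,2)]] step adj_sym adj_trans by metis
    moreover have "mu i v = mu i (t (s v))" using s t uv step(1) by simp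
    ultimately show ?case using mu.color_inj[OF step(1)] by metis
  qed (simp add: s t)
  have st: "s (t x) = x" if "x \<in> C" for x
    using assms(3) that
  proof (induction rule: chambers_induct)
    case (step i u v)
    have uv: "u \<in> C" "v \<in> C" using adj_in step by blast+
    have "(v, s (t v)) \<in> adj D i"
      using s(4)[OF step(1) t(4)[OF step(1,2)]] step adj_sym adj_trans by metis
    moreover have "lam i v = lam i (s (t v))" using s t uv step(1) by simp
    ultimately show ?case using color_inj[OF step(1)] by metis
  qed (simp add: s t)
  define g where "g = restrict s C"
  have "bij_betw s C C" by (rule bij_betw_byWitness[of _ t]) (auto simp: st ts s t)
  then have "bij_betw g C C" using bij_betw_cong[of C g s C] by (simp add: g_def)
  then have "g \<in> Bij C" by (simp add: Bij_def g_def)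
  moreover have "(g x, g y) \<in> adj D i \<longleftrightarrow> (x, y) \<in> adj D i" if "i \<in> I" "x \<in> C" "y \<in> C" for i x y
    using s(4)[of i x y] t(4)[of i "s x" "s y"] that ts by (auto simp: g_def)
  ultimately have "g \<in> aut D" by (simp add: aut_def)
  then show ?thesis by (rule that) (use s assms(2) in \<open>auto simp: g_def\<close>)
qed

text \<open>
  Here \<open>\<epsilon> x\<close> is the \<open>i\<close>-color of the projection of \<open>x\<close> to the wall. It is obtained
  without projections: after embedding the colors into the integers, color differences along the
  \<open>i\<close>-edges of the wall form a flat cocycle, and \<open>\<epsilon>\<close> is its potential.
\<close>

lemma wall_color:
  assumes "i \<in> I" "c \<in> C" "finite (\<Omega> i)"
  obtains \<epsilon> where "\<And>x. x \<in> wall i c \<Longrightarrow> \<epsilon> x = lam i x" "\<And>x. x \<in> C \<Longrightarrow> \<epsilon> x \<in> \<Omega> i"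
    "\<And>j x y. j \<in> I \<Longrightarrow> (x, y) \<in> adj D j \<Longrightarrow> \<not> (j = i \<and> x \<in> wall i c) \<Longrightarrow> \<epsilon> x = \<epsilon> y"
proof -
  let ?W = "wall i c"
  obtain \<phi>' :: "'o \<Rightarrow> nat" where "inj_on \<phi>' (\<Omega> i)"
    using finite_imp_inj_to_nat_seg[OF assms(3)] by blast
  define \<phi> where "\<phi> a = int (\<phi>' a)" for a
  then have \<phi>: "inj_on \<phi> (\<Omega> i)" using \<open>inj_on \<phi>' (\<Omega> i)\<close> by (simp add: inj_on_def)
  define T where "T j x y b = (if j = i \<and> x \<in> ?W then b + \<phi> (lam i y) - \<phi> (lam i x) else b)"
    for j x y and b :: int
  have "flat (\<lambda>_. UNIV) T"
    unfolding flat_def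
  proof (intro conjI ballI allI impI)
    show "T j y z (T j x y b) = T j x z b"
      if "j \<in> I" "(x, y) \<in> adj D j" "(y, z) \<in> adj D j" for j x y z b
      using wall_adj_iff[OF that(1,2)] by (auto simp: T_def)
    show "T l y z (T k x y b) = T k y' z (T l x y' b)"
      if c: "comm k l" and sq: "(x, y) \<in> adj D k" "(y, z) \<in> adj D l" "(x, y') \<in> adj D l"
        "(y', z) \<in> adj D k" for k l x y z y' b
    proof -
      have kl: "k \<in> I" "l \<in> I" "k \<noteq> l" "comm l k"
        using c comm_irrefl comm_sym[OF c] by (auto simp: comm_def)
      \<comment> \<open>If one type is \<open>i\<close>, the two \<open>i\<close>-edges of the
        square have equal end colors and lie both on the wall or both off it, so they add the same
        difference.\<close>
      consider "k = i" | "l = i" | "k \<noteq> i" "l \<noteq> i" by blast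
      then show ?thesis
      proof cases
        case 1
        then have "lam i x = lam i y'" "lam i y = lam i z"
          using color_adj[OF kl(2) assms(1)] sq kl by metis+
        with 1 show ?thesis
          using wall_adj_iff[OF kl(2) sq(3)] c kl by (auto simp: T_def)
      next
        case 2
        then have "lam i x = lam i y" "lam i y' = lam i z"
          using color_adj[OF kl(1) assms(1)] sq kl by metis+
        with 2 show ?thesis
          using wall_adj_iff[OF kl(1) sq(1)] c kl by (auto simp: T_def)
      qed (simp add: T_def)
    qed
  qed (auto simp: T_def)
  from flat_section[OF this assms(2), of "\<phi> (lam i c)"]
  obtain s where s: "s c = \<phi> (lam i c)"
    "\<And>j x y. j \<in> I \<Longrightarrow> (x, y) \<in> adj D j \<Longrightarrow> s y = T j x y (s x)" by auto
  have W: "s x = \<phi> (lam i x)" if "x \<in> ?W" for x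
    using that s(1)
  proof (rule wall_invariant)
    show "s v = \<phi> (lam i v)" if "j = i \<or> comm i j" "j \<in> I" "(u, v) \<in> adj D j" "u \<in> ?W"
      "s u = \<phi> (lam i u)" for j u v
    proof (cases "j = i")
      case True
      with s(2)[OF that(2,3)] that show ?thesis by (simp add: T_def)
    next
      case False
      with s(2)[OF that(2,3)] that color_adj[OF that(2) assms(1) _ that(3)] show ?thesis
        by (simp add: T_def)
    qed
  qed
  \<comment> \<open>The potential changes only on the wall, where it equals an encoded color. Hence
    it always stays in the image of \<open>\<phi>\<close> and can be decoded.\<close>
  have im: "s x \<in> \<phi> ` \<Omega> i" if "x \<in> C" for x
    using assms(2) that
  proof (induction rule: chambers_induct)
    case (step j u v)
    have uv: "u \<in> C" "v \<in> C" using adj_in step by blast+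
    show ?case
    proof (cases "j = i \<and> u \<in> ?W")
      case True
      then have "v \<in> ?W" using wall_adj_iff[OF step(1,2)] by blast
      then show ?thesis using W color_in[OF assms(1) uv(2)] by auto
    next
      case False
      then have "s v = s u" using s(2)[OF step(1,2)] by (auto simp: T_def)
      then show ?thesis using step by simp
    qed
  qed (use s(1) color_in assms in auto)
  show ?thesis
  proof (rule that[of "\<lambda>x. inv_into (\<Omega> i) \<phi> (s x)"])
    show "inv_into (\<Omega> i) \<phi> (s x) = lam i x" if "x \<in> ?W" for x
      using W[OF that] \<phi> color_in[OF assms(1)] wall_in[OF that] by simp
    show "inv_into (\<Omega> i) \<phi> (s x) \<in> \<Omega> i" if "x \<in> C" for x
      using im[OF that] by (rule inv_into_into)
    show "inv_into (\<Omega> i) \<phi> (s x) = inv_into (\<Omega> i) \<phi> (s y)"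
      if "j \<in> I" "(x, y) \<in> adj D j" "\<not> (j = i \<and> x \<in> ?W)" for j x y
      using s(2)[OF that(1,2)] that(3) by (auto simp: T_def)
  qed
qed

section \<open>Projections between the panels of a wall\<close>

lemma wall_descend:
  assumes "i \<in> I" "d \<in> wall i c" "(c, e) \<in> adj D i" "lam i e \<noteq> lam i d"
  shows "\<exists>y. (c, y) \<in> adj D i \<and> gallery_dist D d y < gallery_dist D d e"
proof -
  have "e \<in> wall i d"
    using wall_trans[OF wall_sym[OF assms(2)] wall_adj[OF assms(1,3)]] by blast
  then obtain p where p: "path d p e" "\<forall>j\<in>set (map fst p). j = i \<or> comm i j"
    by (auto simp: wall_def)
  obtain w where w: "irreducible w" "gallery D w d e" "set w \<subseteq> set (map fst p)"
    using irreducible_gallery_exists[OF p(1)] by blast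
  obtain r where r: "path d r e" "map fst r = w" using gallery_path[OF w(2)] by blast
  have types: "\<forall>j\<in>set (map fst r). j = i \<or> comm i j" using r(2) w(3) p(2) by blast
  \<comment> \<open>Without an \<open>i\<close>-edge the color \<open>lam i\<close> would be
    constant along \<open>r\<close>.\<close>
  have "i \<in> set (map fst r)"
  proof (rule ccontr)
    assume no: "i \<notin> set (map fst r)"
    have "lam i e = lam i d"
    proof (rule path_invariant[where Q = "\<lambda>z. lam i z = lam i d", OF r(1)])
      show "lam i v = lam i d"
        if "j \<in> set (map fst r)" "j \<in> I" "(u, v) \<in> adj D j" "lam i u = lam i d" for j u v
        using color_adj[OF that(2) assms(1) _ that(3)] that(1,4) no by metis
    qed simp
    then show False using assms(4) by simp
  qed
  then have "\<exists>a\<in>set r. fst a = i" by auto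
  \<comment> \<open>Cut at the last \<open>i\<close>-edge: all later types commute with
    \<open>i\<close>, so this edge slides to the end of the gallery and into the panel of
    \<open>e\<close>. Dropping it saves one step.\<close>
  then obtain r1 a r2 where s: "r = r1 @ a # r2" "fst a = i" "\<forall>b\<in>set r2. fst b \<noteq> i"
    using split_list_last_prop[of r "\<lambda>a. fst a = i"] by blast
  obtain u where a: "a = (i, u)" using s(2) by (cases a) auto
  obtain v where v: "path d r1 v" "(v, u) \<in> adj D i" "path u r2 e"
    using r(1) s(1) a by (auto simp: path_append)
  have flat: "flat (\<lambda>_. UNIV) (\<lambda>_ _ _ b. b :: unit)" by (simp add: flat_def)
  have "\<forall>j\<in>set (map fst r2). comm i j" using types s by auto
  then obtain q :: "('i \<times> 'c) list" and y
    where q: "path v q y" "(y, e) \<in> adj D i" "map fst q = map fst r2"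
    using shift_edge[OF flat assms(1) v(2,3)] by metis
  have "path d (r1 @ q) y" using v(1) q(1) by (auto simp: path_append)
  then have "gallery_dist D d y \<le> length (r1 @ q)" by (rule gallery_dist_le)
  also have "\<dots> < length r" using s(1) q(3) by (auto dest: map_eq_imp_length_eq)
  also have "\<dots> = gallery_dist D d e"
    using irreducible_gallery_dist[OF w(1,2)] r(2) by auto
  finally have "gallery_dist D d y < gallery_dist D d e" .
  moreover have "(c, y) \<in> adj D i"
    using adj_trans[OF assms(1,3) adj_sym[OF assms(1) q(2)]] .
  ultimately show ?thesis by blast
qed

text \<open>By \<open>wall_descend\<close> a chamber whose \<open>i\<close>-color differs from that
  of \<open>d\<close> is not nearest, and only one chamber of the panel has that color. A minimizer
  exists because distances are natural numbers.\<close>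

lemma chamber_proj_wall:
  assumes "i \<in> I" "d \<in> wall i c"
  shows "chamber_proj D (adj D i `` {c}) d = step i (lam i d) c"
proof -
  have cd: "c \<in> C" "d \<in> C" using wall_in assms by blast+
  let ?p = "step i (lam i d) c"
  let ?min = "is_arg_min (gallery_dist D d) (\<lambda>y. y \<in> adj D i `` {c})"
  have p: "(c, ?p) \<in> adj D i" "lam i ?p = lam i d"
    using step[OF assms(1) cd(1) color_in[OF assms(1) cd(2)]] by blast+
  have uniq: "e = ?p" if "?min e" for e
  proof -
    have e: "(c, e) \<in> adj D i" using that by (simp add: is_arg_min_def)
    have "lam i e = lam i d"
      using wall_descend[OF assms e] that by (auto simp: is_arg_min_def)
    then show ?thesis using step_unique[OF assms(1) e] by simp
  qed
  obtain e where "e \<in> adj D i `` {c}"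
      "\<forall>y. y \<in> adj D i `` {c} \<longrightarrow> gallery_dist D d e \<le> gallery_dist D d y"
    using ex_has_least_nat[of "\<lambda>y. y \<in> adj D i `` {c}" ?p "gallery_dist D d"] p by blast
  then have e: "?min e" unfolding is_arg_min_def by (meson not_less)
  then have "?min ?p" using uniq[OF e] by simp
  then show ?thesis unfolding chamber_proj_def by (rule the_equality) (rule uniq)
qed

lemma chamber_proj_panel:
  assumes "i \<in> I" "d \<in> wall i c"
  shows "chamber_proj D (adj D i `` {c}) ` (adj D i `` {d}) = adj D i `` {c}"
proof
  have cd: "c \<in> C" "d \<in> C" using wall_in assms by blast+
  have proj: "chamber_proj D (adj D i `` {c}) e = step i (lam i e) c" if "(d, e) \<in> adj D i" for e
    using chamber_proj_wall[OF assms(1)] wall_trans[OF assms(2) wall_adj[OF assms(1) that]] by blast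
  show "chamber_proj D (adj D i `` {c}) ` (adj D i `` {d}) \<subseteq> adj D i `` {c}"
  proof (intro subsetI, elim imageE)
    fix y e assume y: "y = chamber_proj D (adj D i `` {c}) e" "e \<in> adj D i `` {d}"
    then have e: "(d, e) \<in> adj D i" by simp
    then have "lam i e \<in> \<Omega> i" using color_in adj_in assms(1) by blast
    then show "y \<in> adj D i `` {c}"
      using proj[OF e] step_adj[OF assms(1) cd(1)] y(1) by simp
  qed
  show "adj D i `` {c} \<subseteq> chamber_proj D (adj D i `` {c}) ` (adj D i `` {d})"
  proof
    fix y assume "y \<in> adj D i `` {c}"
    then have y: "(c, y) \<in> adj D i" by simp
    then have ly: "lam i y \<in> \<Omega> i" using color_in adj_in assms(1) by blast
    let ?e = "step i (lam i y) d"
    have e: "(d, ?e) \<in> adj D i" "lam i ?e = lam i y"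
      using step[OF assms(1) cd(2) ly] by blast+
    then have "chamber_proj D (adj D i `` {c}) ?e = y"
      using proj[OF e(1)] step_unique[OF assms(1) y] by simp
    then show "y \<in> chamber_proj D (adj D i `` {c}) ` (adj D i `` {d})" using e(1) by force
  qed
qed

text \<open>Projection matches chambers of equal color, in both directions. This supplies the
  parallelism required in \<open>panel_group\<close>.\<close>

lemma parallel_wall:
  assumes "i \<in> I" "d \<in> wall i c"
  shows "parallel D (adj D i `` {d}) (adj D i `` {c})"
  unfolding parallel_def
  using chamber_proj_panel[OF assms] chamber_proj_panel[OF assms(1) wall_sym[OF assms(2)]] by simp

end

section \<open>Local actions\<close>

lemma (in group) mult_mem_subgroup_iff:
  assumes "subgroup H G" "b \<in> H" "a \<in> carrier G"
  shows "a \<otimes> b \<in> H \<longleftrightarrow> a \<in> H" "b \<otimes> a \<in> H \<longleftrightarrow> a \<in> H"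
proof -
  interpret H: subgroup H G by fact
  have b: "b \<in> carrier G" using assms(2) by (rule H.mem_carrier)
  have "a = a \<otimes> b \<otimes> inv b" "a = inv b \<otimes> (b \<otimes> a)"
    using assms(3) b by (simp_all add: m_assoc flip: m_assoc[of "inv b"])
  then show "a \<otimes> b \<in> H \<longleftrightarrow> a \<in> H" "b \<otimes> a \<in> H \<longleftrightarrow> a \<in> H"
    using H.m_closed H.m_inv_closed assms(2) by metis+
qed

context colored_building
begin

abbreviation loc :: "'i \<Rightarrow> ('c \<Rightarrow> 'c) \<Rightarrow> 'c \<Rightarrow> 'o \<Rightarrow> 'o" where
  "loc i g x \<equiv> local_action \<Omega> lam i g (adj D i `` {x})"

abbreviation Sing :: "('i \<Rightarrow> ('o \<Rightarrow> 'o) set) \<Rightarrow> ('c \<Rightarrow> 'c) \<Rightarrow> 'c set set" where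
  "Sing \<equiv> singularities D \<Omega> lam"

lemma loc_eq: "loc i g x = (\<lambda>a\<in>\<Omega> i. lam i (g (step i a x)))"
  by (simp add: local_action_def step_def)

section \<open>Automorphisms and the cocycle of their local actions\<close>

lemma autD:
  assumes "g \<in> aut D"
  shows aut_bij: "bij_betw g C C"
    and aut_adj: "i \<in> I \<Longrightarrow> (x, y) \<in> adj D i \<Longrightarrow> (g x, g y) \<in> adj D i"
    and aut_in: "x \<in> C \<Longrightarrow> g x \<in> C"
proof -
  show g: "bij_betw g C C" using assms by (simp add: aut_def Bij_def)
  show "g x \<in> C" if "x \<in> C" using bij_betw_apply[OF g that] .
  show "(g x, g y) \<in> adj D i" if "i \<in> I" "(x, y) \<in> adj D i"
    using assms that adj_in[OF that(2,1)] by (auto simp: aut_def)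
qed

lemma aut_panel:
  assumes "g \<in> aut D" "i \<in> I" "x \<in> C"
  shows "g ` (adj D i `` {x}) = adj D i `` {g x}"
proof
  show "g ` (adj D i `` {x}) \<subseteq> adj D i `` {g x}" using aut_adj[OF assms(1,2)] by blast
  show "adj D i `` {g x} \<subseteq> g ` (adj D i `` {x})"
  proof
    fix y assume "y \<in> adj D i `` {g x}"
    then have y: "(g x, y) \<in> adj D i" by simp
    then have "y \<in> g ` C" using adj_in[OF y assms(2)] aut_bij[OF assms(1)] by (simp add: bij_betw_def)
    then obtain z where z: "z \<in> C" "y = g z" by blast
    then have "(x, z) \<in> adj D i" using assms y by (simp add: aut_def)
    with z show "y \<in> g ` (adj D i `` {x})" by blast
  qed
qed

lemma aut_id: "(\<lambda>x\<in>C. x) \<in> aut D"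
  by (simp add: aut_def id_Bij)

lemma aut_compose: "g \<in> aut D \<Longrightarrow> h \<in> aut D \<Longrightarrow> compose C g h \<in> aut D"
  using aut_in[of h] by (auto simp: aut_def compose_Bij compose_eq)

lemma aut_inv:
  assumes "g \<in> aut D"
  shows "(\<lambda>x\<in>C. inv_into C g x) \<in> aut D"
proof -
  have g: "bij_betw g C C" by (rule aut_bij[OF assms])
  have "inv_into C g x \<in> C" "g (inv_into C g x) = x" if "x \<in> C" for x
    using that g by (auto simp: bij_betw_def intro: inv_into_into f_inv_into_f)
  moreover have "(inv_into C g x, inv_into C g y) \<in> adj D i \<longleftrightarrow>
      (g (inv_into C g x), g (inv_into C g y)) \<in> adj D i" if "i \<in> I" "x \<in> C" "y \<in> C" for i x y
    using assms that calculation(1) by (simp add: aut_def)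
  ultimately show ?thesis using assms by (simp add: aut_def restrict_inv_into_Bij)
qed

lemma subgroup_aut: "subgroup (aut D) (BijGroup C)"
proof
  show "aut D \<subseteq> carrier (BijGroup C)" by (auto simp: aut_def BijGroup_def)
  show "x \<otimes>\<^bsub>BijGroup C\<^esub> y \<in> aut D" if "x \<in> aut D" "y \<in> aut D" for x y
    using aut_compose[OF that] that by (simp add: BijGroup_def aut_def)
  show "\<one>\<^bsub>BijGroup C\<^esub> \<in> aut D" using aut_id by (simp add: BijGroup_def)
  show "inv\<^bsub>BijGroup C\<^esub> x \<in> aut D" if "x \<in> aut D" for x
    using aut_inv[OF that] that by (simp add: inv_BijGroup aut_def)
qed

lemma group_Aut: "group (Aut_group D)"
  unfolding Aut_group_def by (rule subgroup.subgroup_is_group[OF subgroup_aut group_BijGroup])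

lemma Aut_carrier: "carrier (Aut_group D) = aut D"
  by (simp add: Aut_group_def)

lemma Aut_mult: "g \<in> aut D \<Longrightarrow> h \<in> aut D \<Longrightarrow> g \<otimes>\<^bsub>Aut_group D\<^esub> h = compose C g h"
  by (auto simp: Aut_group_def BijGroup_def aut_def)

lemma loc_Bij:
  assumes "g \<in> aut D" "i \<in> I" "x \<in> C"
  shows "loc i g x \<in> Bij (\<Omega> i)"
proof -
  have 1: "bij_betw (\<lambda>a. step i a x) (\<Omega> i) (adj D i `` {x})"
    unfolding step_def by (rule bij_betw_inv_into[OF color_bij[OF assms(2,3)]])
  have "inj_on g C" using aut_bij[OF assms(1)] by (simp add: bij_betw_def)
  moreover have "adj D i `` {x} \<subseteq> C" using adj_chambers[OF assms(2)] by blast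
  ultimately have "inj_on g (adj D i `` {x})" by (rule inj_on_subset)
  then have 2: "bij_betw g (adj D i `` {x}) (adj D i `` {g x})"
    using aut_panel[OF assms] by (simp add: bij_betw_def)
  have "bij_betw (lam i \<circ> (g \<circ> (\<lambda>a. step i a x))) (\<Omega> i) (\<Omega> i)"
    using bij_betw_trans[OF bij_betw_trans[OF 1 2] color_bij[OF assms(2) aut_in[OF assms(1,3)]]]
    by simp
  then have "bij_betw (loc i g x) (\<Omega> i) (\<Omega> i)"
    by (rule bij_betw_cong[THEN iffD1, rotated]) (simp add: loc_eq)
  then show ?thesis by (simp add: Bij_def loc_eq)
qed

lemma loc_compose:
  assumes "g \<in> aut D" "h \<in> aut D" "i \<in> I" "x \<in> C"
  shows "loc i (compose C g h) x = loc i g (h x) \<otimes>\<^bsub>BijGroup (\<Omega> i)\<^esub> loc i h x"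
proof -
  have "loc i (compose C g h) x a = compose (\<Omega> i) (loc i g (h x)) (loc i h x) a"
    if a: "a \<in> \<Omega> i" for a
  proof -
    note s = step[OF assms(3,4) a]
    have "lam i (h (step i a x)) \<in> \<Omega> i"
      by (rule color_in[OF assms(3) aut_in[OF assms(2) s(3)]])
    moreover have "step i (lam i (h (step i a x))) (h x) = h (step i a x)"
      by (rule step_unique[OF assms(3) aut_adj[OF assms(2,3) s(1)]])
    ultimately show ?thesis using a s(3) by (simp add: loc_eq compose_eq)
  qed
  then have "loc i (compose C g h) x = compose (\<Omega> i) (loc i g (h x)) (loc i h x)"
    by (intro extensionalityI[of _ "\<Omega> i"]) (auto simp: local_action_def)
  then show ?thesis
    using loc_Bij[OF assms(1,3) aut_in[OF assms(2,4)]] loc_Bij[OF assms(2-4)]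
    by (simp add: BijGroup_def)
qed

lemma loc_id:
  assumes "i \<in> I" "x \<in> C"
  shows "loc i (\<lambda>x\<in>C. x) x = \<one>\<^bsub>BijGroup (\<Omega> i)\<^esub>"
  using step_in[OF assms] step_color[OF assms] by (auto simp: loc_eq BijGroup_def fun_eq_iff)

text \<open>A \<open>j\<close>-edge with \<open>j\<close> commuting with \<open>i\<close> joins two
  \<open>i\<close>-panels by squares that match equal \<open>i\<close>-colors. Automorphisms
  preserve \<open>j\<close>-adjacency, so the images are matched by color as well.\<close>

lemma loc_wall:
  assumes "g \<in> aut D" "i \<in> I" "y \<in> wall i x"
  shows "loc i g y = loc i g x"
  using assms(3)
proof (rule wall_invariant)
  show "loc i g v = loc i g x"
    if "j = i \<or> comm i j" "j \<in> I" "(u, v) \<in> adj D j" "loc i g u = loc i g x" for j u v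
  proof (cases "j = i")
    case True
    then have "adj D i `` {v} = adj D i `` {u}" using panel_eqI that by metis
    then show ?thesis using that by simp
  next
    case False
    then have c: "comm i j" using that by simp
    have uv: "u \<in> C" "v \<in> C" using adj_in that by blast+
    have "lam i (g (step i a u)) = lam i (g (step i a v))" if a: "a \<in> \<Omega> i" for a
    proof -
      note s = step[OF assms(2) uv(1) a]
      obtain w where w: "(step i a u, w) \<in> adj D j" "(w, v) \<in> adj D i"
        using square[OF c adj_sym[OF assms(2) s(1)] \<open>(u, v) \<in> adj D j\<close>] by (elim exE conjE)
      have "lam i w = a" using color_adj[OF \<open>j \<in> I\<close> assms(2) _ w(1)] False s(2) by simp
      then have "step i a v = w" using step_unique[OF assms(2) adj_sym[OF assms(2) w(2)]] by simp
      then show ?thesis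
        using color_adj[OF \<open>j \<in> I\<close> assms(2) _ aut_adj[OF assms(1) \<open>j \<in> I\<close> w(1)]] False by simp
    qed
    then have "loc i g v = loc i g u" by (auto simp: loc_eq)
    then show ?thesis using that by simp
  qed
qed simp

lemma singularities_eq:
  "Sing F g = {adj D i `` {x} | i x. i \<in> I \<and> x \<in> C \<and> loc i g x \<notin> F i}"
  unfolding singularities_def by (auto simp: panels_eq)

text \<open>On an \<open>i\<close>-panel \<open>lam i\<close> is injective, on a panel of another
  type it is constant, and panels have at least two chambers.\<close>

lemma panel_type_unique:
  assumes "i \<in> I" "j \<in> I" "x \<in> C" "adj D i `` {x} = adj D j `` {y}"
  shows "i = j"
proof (rule ccontr)
  assume neq: "i \<noteq> j"
  obtain z where z: "(x, z) \<in> adj D i" "x \<noteq> z" using panel_nontrivial[OF assms(1,3)] by blast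
  have "(y, x) \<in> adj D j" "(y, z) \<in> adj D j"
    using assms(4) z(1) adj_refl[OF assms(1,3)] by blast+
  then have "(x, z) \<in> adj D j" using adj_trans[OF assms(2) adj_sym[OF assms(2)]] by blast
  then have "lam i x = lam i z" by (rule color_adj[OF assms(2,1) neq])
  then show False using color_inj[OF assms(1) z(1)] z(2) by simp
qed

lemma univ_group_iff:
  "g \<in> univ_group D \<Omega> lam F \<longleftrightarrow> g \<in> aut D \<and> (\<forall>i\<in>I. \<forall>x\<in>C. loc i g x \<in> F i)"
  by (auto simp: univ_group_def panels_eq)

text \<open>Recoloring with one permutation \<open>f k\<close> for each type is again legal, and the
  resulting automorphism has local action \<open>f k\<close> at every
  \<open>k\<close>-panel.\<close>

lemma univ_group_transitive:
  assumes "x \<in> C" "y \<in> C" "local_data I \<Omega> F"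
    and "\<And>k. k \<in> I \<Longrightarrow> \<exists>f\<in>F k. f (lam k x) = lam k y"
  obtains u where "u \<in> univ_group D \<Omega> lam F" "u x = y"
proof -
  obtain f where f: "\<And>k. k \<in> I \<Longrightarrow> f k \<in> F k" "\<And>k. k \<in> I \<Longrightarrow> f k (lam k x) = lam k y"
    using assms(4) by metis
  have fB: "f k \<in> Bij (\<Omega> k)" if "k \<in> I" for k
    using assms(3) f(1) that subgroup.mem_carrier by (fastforce simp: local_data_def BijGroup_def)
  define mu where "mu k z = f k (lam k z)" for k z
  have "legal_coloring D \<Omega> mu"
    unfolding legal_coloring_def
  proof (intro conjI ballI)
    show "mu k \<in> C \<rightarrow> \<Omega> k" if "k \<in> I" for k
      using Bij_imp_funcset[OF fB[OF that]] color_in[OF that] by (auto simp: mu_def)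
    fix k P assume k: "k \<in> I" and P: "P \<in> panels D k"
    from P obtain z where z: "z \<in> C" "P = adj D k `` {z}" using panels_eq[OF k] by blast
    have "bij_betw (f k) (\<Omega> k) (\<Omega> k)" using fB[OF k] by (simp add: Bij_def)
    then have "bij_betw (f k \<circ> lam k) P (\<Omega> k)"
      using bij_betw_trans[OF color_bij[OF k z(1)]] z(2) by blast
    moreover have "mu k = f k \<circ> lam k" by (simp add: mu_def fun_eq_iff)
    ultimately show "bij_betw (mu k) P (\<Omega> k)" by simp
    show "mu j v = mu j w" if "j \<in> I - {k}" "v \<in> P" "w \<in> P" for j v w
    proof -
      have "lam j v = lam j w" using coloring k P that unfolding legal_coloring_def by blast
      then show ?thesis by (simp add: mu_def)
    qed
  qed
  moreover have "lam k y = mu k x" if "k \<in> I" for k using f(2)[OF that] by (simp add: mu_def)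
  ultimately obtain u where u: "u \<in> aut D" "u x = y"
      "\<And>z k. z \<in> C \<Longrightarrow> k \<in> I \<Longrightarrow> lam k (u z) = mu k z"
    using colored_automorphism[OF _ assms(1,2), of mu] by blast
  have "loc k u z = f k" if "k \<in> I" "z \<in> C" for k z
    using Bij_imp_extensional[OF fB[OF that(1)]] step_in[OF that] step_color[OF that] u(3) that(1)
    by (auto simp: loc_eq mu_def fun_eq_iff extensional_def)
  then have "u \<in> univ_group D \<Omega> lam F" using u(1) f(1) by (simp add: univ_group_iff)
  then show ?thesis using that u(2) by blast
qed

text \<open>
  Prescribes \<open>a\<close> on a whole wall and extends it to the wings \<open>\<epsilon> = \<omega>\<close> by elements of
  \<open>F i\<close> agreeing with \<open>a\<close> at \<open>\<omega>\<close>.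
\<close>

lemma wall_automorphism:
  assumes "i \<in> I" "c \<in> C" "finite (\<Omega> i)" "local_data I \<Omega> F" "a \<in> young_overgroup (\<Omega> i) (F i)"
  obtains h where "h \<in> aut D" "h ` (adj D i `` {c}) = adj D i `` {c}"
    "\<And>d. d \<in> wall i c \<Longrightarrow> loc i h d = a"
    "\<And>j d. j \<in> I \<Longrightarrow> d \<in> C \<Longrightarrow> \<not> (j = i \<and> d \<in> wall i c) \<Longrightarrow> loc j h d \<in> F j"
proof -
  have sub: "subgroup (F j) (BijGroup (\<Omega> j))" if "j \<in> I" for j
    using assms(4) that by (simp add: local_data_def)
  have FB: "F j \<subseteq> Bij (\<Omega> j)" if "j \<in> I" for j
    using subgroup.subset[OF sub[OF that]] by (simp add: BijGroup_def)
  have one: "(\<lambda>x\<in>\<Omega> j. x) \<in> F j" if "j \<in> I" for j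
    using subgroup.one_closed[OF sub[OF that]] by (simp add: BijGroup_def)
  have aB: "a \<in> Bij (\<Omega> i)" using assms(5) by (simp add: young_overgroup_def)
  \<comment> \<open>Here the Young overgroup enters: \<open>a\<close> preserves the orbit of each
    \<open>\<omega>\<close>, so some element of \<open>F i\<close> takes the same value
    there.\<close>
  have "\<exists>f\<in>F i. f \<omega> = a \<omega>" if w: "\<omega> \<in> \<Omega> i" for \<omega>
  proof -
    define B where "B = {f \<omega> | f. f \<in> F i}"
    have "B \<in> perm_orbits (\<Omega> i) (F i)"
      using w by (auto simp: B_def perm_orbits_def orbits_def orbit_def)
    then have "a ` B = B" using assms(5) by (simp add: young_overgroup_def)
    moreover have "\<omega> \<in> B" unfolding B_def
      by (intro CollectI exI[of _ "\<lambda>x\<in>\<Omega> i. x"]) (use one[OF assms(1)] w in simp)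
    ultimately have "a \<omega> \<in> B" by blast
    then show ?thesis by (auto simp: B_def)
  qed
  then obtain f where f: "\<And>\<omega>. \<omega> \<in> \<Omega> i \<Longrightarrow> f \<omega> \<in> F i" "\<And>\<omega>. \<omega> \<in> \<Omega> i \<Longrightarrow> f \<omega> \<omega> = a \<omega>"
    by metis
  have fB: "f \<omega> \<in> Bij (\<Omega> i)" if "\<omega> \<in> \<Omega> i" for \<omega>
    using f(1)[OF that] FB[OF assms(1)] by blast
  obtain \<epsilon> where \<epsilon>: "\<And>x. x \<in> wall i c \<Longrightarrow> \<epsilon> x = lam i x" "\<And>x. x \<in> C \<Longrightarrow> \<epsilon> x \<in> \<Omega> i"
    "\<And>j x y. j \<in> I \<Longrightarrow> (x, y) \<in> adj D j \<Longrightarrow> \<not> (j = i \<and> x \<in> wall i c) \<Longrightarrow> \<epsilon> x = \<epsilon> y"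
    using wall_color[OF assms(1-3)] by blast
  \<comment> \<open>On the wall \<open>\<epsilon> x\<close> is the color itself, so the formula
    evaluates to \<open>a\<close>. Off the wall \<open>\<epsilon>\<close> is constant on each
    \<open>i\<close>-panel, so a single element of \<open>F i\<close> acts there.\<close>
  define mu where "mu j x = (if j = i then f (\<epsilon> x) (lam i x) else lam j x)" for j x
  have mu_wall: "mu i y = a (lam i y)" if "y \<in> wall i c" for y
    using \<epsilon>(1)[OF that] f(2) color_in[OF assms(1)] wall_in[OF that] by (simp add: mu_def)
  have mu_off: "mu i y = f (\<epsilon> x) (lam i y)" if "(x, y) \<in> adj D i" "x \<notin> wall i c" for x y
    using \<epsilon>(3)[OF assms(1) that(1)] that(2) by (simp add: mu_def)
  have "legal_coloring D \<Omega> mu"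
    unfolding legal_coloring_def
  proof (intro conjI ballI)
    show "mu k \<in> C \<rightarrow> \<Omega> k" if "k \<in> I" for k
    proof
      fix x assume x: "x \<in> C"
      have "f (\<epsilon> x) (lam i x) \<in> \<Omega> i"
        by (rule funcset_mem[OF Bij_imp_funcset[OF fB[OF \<epsilon>(2)[OF x]]] color_in[OF assms(1) x]])
      then show "mu k x \<in> \<Omega> k" using color_in[OF that x] by (simp add: mu_def)
    qed
    fix k P assume k: "k \<in> I" and P: "P \<in> panels D k"
    from P obtain z where z: "z \<in> C" "P = adj D k `` {z}" using panels_eq[OF k] by blast
    show "bij_betw (mu k) P (\<Omega> k)"
    proof (cases "k = i")
      case False
      then have "mu k = lam k" by (auto simp: mu_def)
      then show ?thesis using color_bij[OF k z(1)] z(2) by simp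
    next
      case True
      obtain b where b: "b \<in> Bij (\<Omega> i)" "\<And>y. y \<in> P \<Longrightarrow> mu i y = b (lam i y)"
      proof (cases "z \<in> wall i c")
        case True
        with z \<open>k = i\<close> show ?thesis
          using that[OF aB] mu_wall wall_adj_iff[OF assms(1)] by blast
      next
        case False
        with z \<open>k = i\<close> show ?thesis
          using that[OF fB[OF \<epsilon>(2)[OF z(1)]]] mu_off by blast
      qed
      have "bij_betw b (\<Omega> i) (\<Omega> i)" using b(1) by (simp add: Bij_def)
      then have "bij_betw (b \<circ> lam i) P (\<Omega> i)"
        using bij_betw_trans[OF color_bij[OF assms(1) z(1)]] z(2) True by blast
      then have "bij_betw (mu i) P (\<Omega> i)"
        by (rule bij_betw_cong[THEN iffD1, rotated]) (simp add: b(2))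
      then show ?thesis using True by simp
    qed
    show "mu j v = mu j w" if j: "j \<in> I - {k}" and vw: "v \<in> P" "w \<in> P" for j v w
    proof -
      have "(z, v) \<in> adj D k" "(z, w) \<in> adj D k" using vw z(2) by auto
      then have vw': "(v, w) \<in> adj D k" using adj_trans[OF k adj_sym[OF k]] by blast
      have "lam j v = lam j w" by (rule color_adj[OF k _ _ vw']) (use j in auto)
      moreover have "\<epsilon> v = \<epsilon> w" if "j = i" using \<epsilon>(3)[OF k vw'] j that by auto
      ultimately show ?thesis by (cases "j = i") (simp_all add: mu_def)
    qed
  qed
  \<comment> \<open>The image of \<open>c\<close> must carry the colors \<open>mu k c\<close>.
    Choosing it in the \<open>i\<close>-panel of \<open>c\<close> makes \<open>h\<close> stabilize
    that panel.\<close>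
  define c' where "c' = step i (a (lam i c)) c"
  have ac: "a (lam i c) \<in> \<Omega> i" using Bij_imp_funcset[OF aB] color_in[OF assms(1,2)] by blast
  note c' = step[OF assms(1,2) ac, folded c'_def]
  have c'_mu: "lam k c' = mu k c" if k: "k \<in> I" for k
  proof (cases "k = i")
    case True
    then show ?thesis using c'(2) mu_wall[OF wall_refl[OF assms(2)]] by simp
  next
    case False
    then show ?thesis using color_adj[OF assms(1) k False c'(1)] by (simp add: mu_def)
  qed
  obtain h where h: "h \<in> aut D" "h c = c'"
    "\<And>x k. x \<in> C \<Longrightarrow> k \<in> I \<Longrightarrow> lam k (h x) = mu k x"
    using colored_automorphism[OF \<open>legal_coloring D \<Omega> mu\<close> assms(2) c'(3) c'_mu] by blast
  have loc: "loc j h d = b" if "j \<in> I" "d \<in> C" "b \<in> extensional (\<Omega> j)"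
    "\<And>y. (d, y) \<in> adj D j \<Longrightarrow> mu j y = b (lam j y)" for j d b
  proof
    fix \<omega> show "loc j h d \<omega> = b \<omega>"
    proof (cases "\<omega> \<in> \<Omega> j")
      case True
      note s = step[OF that(1,2) True]
      show ?thesis using h(3)[OF s(3) that(1)] that(4)[OF s(1)] s(2) True by (simp add: loc_eq)
    next
      case False
      then show ?thesis using that(3) by (simp add: loc_eq extensional_def)
    qed
  qed
  show ?thesis
  proof (rule that[OF h(1)])
    show "h ` (adj D i `` {c}) = adj D i `` {c}"
      using aut_panel[OF h(1) assms(1,2)] h(2) panel_eqI[OF assms(1) c'(1)] by simp
    show "loc i h d = a" if d: "d \<in> wall i c" for d
    proof (rule loc[OF assms(1)])
      show "d \<in> C" using wall_in[OF d] ..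
      show "a \<in> extensional (\<Omega> i)" by (rule Bij_imp_extensional[OF aB])
      show "mu i y = a (lam i y)" if "(d, y) \<in> adj D i" for y
        using mu_wall wall_adj_iff[OF assms(1) that] d by blast
    qed
    show "loc j h d \<in> F j" if j: "j \<in> I" and d: "d \<in> C" and off: "\<not> (j = i \<and> d \<in> wall i c)" for j d
    proof (cases "j = i")
      case True
      have "loc i h d = f (\<epsilon> d)"
        using off True mu_off
        by (intro loc[OF assms(1) d Bij_imp_extensional[OF fB[OF \<epsilon>(2)[OF d]]]]) auto
      then show ?thesis using f(1)[OF \<epsilon>(2)[OF d]] True by simp
    next
      case False
      have "loc j h d = (\<lambda>x\<in>\<Omega> j. x)"
      proof (rule loc[OF j d])
        show "mu j y = (\<lambda>x\<in>\<Omega> j. x) (lam j y)" if "(d, y) \<in> adj D j" for y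
          using False color_in[OF j] adj_in[OF that j] by (simp add: mu_def)
      qed simp
      then show ?thesis using one[OF j] by simp
    qed
  qed
qed

end

section \<open>Generators of the restricted universal group\<close>

locale local_data_building = colored_building D m \<delta> \<Omega> lam
  for D :: "('i, 'c) chamber_system" and m \<delta> and \<Omega> :: "'i \<Rightarrow> 'o set" and lam +
  fixes F F' :: "'i \<Rightarrow> ('o \<Rightarrow> 'o) set"
  assumes finite_index: "finite (index_set D)"
    and finite_colors: "i \<in> index_set D \<Longrightarrow> finite (\<Omega> i)"
    and data: "local_data (index_set D) \<Omega> F" "local_data (index_set D) \<Omega> F'"
    and data_mono: "i \<in> index_set D \<Longrightarrow> F i \<subseteq> F' i"
    and data_young: "i \<in> index_set D \<Longrightarrow> F' i \<subseteq> young_overgroup (\<Omega> i) (F i)"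
begin

abbreviation "G \<equiv> restricted_univ_group D \<Omega> lam F F'"

section \<open>The restricted universal group and its singularities\<close>

lemma subgroup_data:
  "i \<in> I \<Longrightarrow> subgroup (F i) (BijGroup (\<Omega> i))" "i \<in> I \<Longrightarrow> subgroup (F' i) (BijGroup (\<Omega> i))"
  using data by (auto simp: local_data_def)

lemma loc_carrier:
  "g \<in> aut D \<Longrightarrow> i \<in> I \<Longrightarrow> x \<in> C \<Longrightarrow> loc i g x \<in> carrier (BijGroup (\<Omega> i))"
  using loc_Bij by (simp add: BijGroup_def)

lemma restricted_iff:
  "g \<in> G \<longleftrightarrow> g \<in> aut D \<and> finite (Sing F g) \<and> (\<forall>i\<in>I. \<forall>x\<in>C. loc i g x \<in> F' i)"
proof -
  have "Sing F g = (\<Union>i\<in>I. {P \<in> panels D i. local_action \<Omega> lam i g P \<notin> F i})"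
    by (auto simp: singularities_def)
  then have "finite (Sing F g) \<longleftrightarrow>
      (\<forall>i\<in>I. finite {P \<in> panels D i. local_action \<Omega> lam i g P \<notin> F i})"
    using finite_index by simp
  then show ?thesis
    by (auto simp: restricted_univ_group_def almost_univ_group_def univ_group_iff)
qed

lemma singularitiesE:
  assumes "P \<in> Sing F g"
  obtains i x where "i \<in> I" "x \<in> C" "P = adj D i `` {x}" "loc i g x \<notin> F i"
  using assms unfolding singularities_eq by blast

lemma singularitiesI: "i \<in> I \<Longrightarrow> x \<in> C \<Longrightarrow> loc i g x \<notin> F i \<Longrightarrow> adj D i `` {x} \<in> Sing F g"
  unfolding singularities_eq by blast

lemma finite_panel_preimage:
  assumes "g \<in> aut D" "finite S"
  shows "finite {P. P \<subseteq> C \<and> g ` P \<in> S}"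
proof -
  have "inj_on ((`) g) (Pow C)"
    using aut_bij[OF assms(1)] by (intro inj_on_image_Pow) (simp add: bij_betw_def)
  then have "finite ((`) g -` S \<inter> Pow C)" by (rule finite_vimage_IntI[OF assms(2)])
  then show ?thesis by (rule rev_finite_subset) auto
qed

lemma panel_subset: "i \<in> I \<Longrightarrow> adj D i `` {x} \<subseteq> C"
  using adj_chambers by blast

lemma loc_inv:
  assumes "g \<in> aut D" "i \<in> I" "x \<in> C"
  defines "h \<equiv> \<lambda>x\<in>C. inv_into C g x"
  shows "loc i g (h x) \<otimes>\<^bsub>BijGroup (\<Omega> i)\<^esub> loc i h x = \<one>\<^bsub>BijGroup (\<Omega> i)\<^esub>"
proof -
  have h: "h \<in> aut D" unfolding h_def by (rule aut_inv[OF assms(1)])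
  have "compose C g h = (\<lambda>x\<in>C. x)"
    using aut_bij[OF assms(1)]
    by (auto simp: h_def compose_def fun_eq_iff bij_betw_def intro: f_inv_into_f)
  then show ?thesis using loc_compose[OF assms(1) h assms(2,3)] loc_id[OF assms(2,3)] by simp
qed

lemma loc_inv_mem:
  assumes "g \<in> aut D" "i \<in> I" "x \<in> C" "subgroup H (BijGroup (\<Omega> i))"
  defines "h \<equiv> \<lambda>x\<in>C. inv_into C g x"
  assumes "loc i g (h x) \<in> H"
  shows "loc i h x \<in> H"
proof -
  have h: "h \<in> aut D" unfolding h_def by (rule aut_inv[OF assms(1)])
  have "loc i g (h x) \<otimes>\<^bsub>BijGroup (\<Omega> i)\<^esub> loc i h x \<in> H"
    using loc_inv[OF assms(1-3)] subgroup.one_closed[OF assms(4)] by (simp add: h_def)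
  then show ?thesis
    using group.mult_mem_subgroup_iff(2)[OF group_BijGroup assms(4) assms(6) loc_carrier[OF h assms(2,3)]]
    by simp
qed

text \<open>By the cocycle rule a singular panel of a product is singular for the right factor or is
  carried by it to a singular panel of the left factor; a singular panel of an inverse is likewise
  carried to one of the original. Automorphisms are injective on panels, so finiteness
  persists.\<close>

lemma subgroup_restricted: "subgroup G (Aut_group D)"
proof -
  interpret group "Aut_group D" by (rule group_Aut)
  show ?thesis
  proof (rule subgroupI)
    show "G \<subseteq> carrier (Aut_group D)" by (auto simp: restricted_iff Aut_carrier)
    have id: "loc i (\<lambda>x\<in>C. x) x \<in> F i" "loc i (\<lambda>x\<in>C. x) x \<in> F' i" if "i \<in> I" "x \<in> C" for i x
      using loc_id[OF that] subgroup_data[OF that(1), THEN subgroup.one_closed] by simp_all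
    have "Sing F (\<lambda>x\<in>C. x) = {}" unfolding singularities_eq using id(1) by blast
    then have "(\<lambda>x\<in>C. x) \<in> G" using id(2) by (simp add: restricted_iff aut_id)
    then show "G \<noteq> {}" by blast
  next
    fix g assume g: "g \<in> G"
    then have ga: "g \<in> aut D" by (simp add: restricted_iff)
    define h where "h = (\<lambda>x\<in>C. inv_into C g x)"
    have h: "h \<in> aut D" unfolding h_def by (rule aut_inv[OF ga])
    have "inv\<^bsub>Aut_group D\<^esub> g = inv\<^bsub>BijGroup C\<^esub> g"
      unfolding Aut_group_def by (rule group.m_inv_consistent[OF group_BijGroup subgroup_aut ga])
    also have "\<dots> = h" using ga by (simp add: inv_BijGroup h_def aut_def)
    finally have inv: "inv\<^bsub>Aut_group D\<^esub> g = h" .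
    have "Sing F h \<subseteq> {P. P \<subseteq> C \<and> h ` P \<in> Sing F g}"
    proof
      fix P assume "P \<in> Sing F h"
      then obtain i x where ix: "i \<in> I" "x \<in> C" "P = adj D i `` {x}" "loc i h x \<notin> F i"
        by (rule singularitiesE)
      then have "loc i g (h x) \<notin> F i"
        using loc_inv_mem[OF ga ix(1,2) subgroup_data(1)[OF ix(1)]] by (auto simp: h_def)
      then have "adj D i `` {h x} \<in> Sing F g"
        by (intro singularitiesI ix aut_in[OF h])
      then show "P \<in> {P. P \<subseteq> C \<and> h ` P \<in> Sing F g}"
        using aut_panel[OF h ix(1,2)] ix(3) panel_subset[OF ix(1)] by simp
    qed
    moreover have "finite {P. P \<subseteq> C \<and> h ` P \<in> Sing F g}"
      using g by (intro finite_panel_preimage[OF h]) (simp add: restricted_iff)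
    ultimately have "finite (Sing F h)" by (rule finite_subset)
    moreover have "loc i h x \<in> F' i" if "i \<in> I" "x \<in> C" for i x
      using loc_inv_mem[OF ga that subgroup_data(2)[OF that(1)]] g that aut_in[OF h that(2)]
      by (simp add: h_def restricted_iff)
    ultimately show "inv\<^bsub>Aut_group D\<^esub> g \<in> G" using h by (simp add: inv restricted_iff)
  next
    fix g h assume g: "g \<in> G" and h: "h \<in> G"
    then have gh: "g \<in> aut D" "h \<in> aut D" by (auto simp: restricted_iff)
    have "Sing F (compose C g h) \<subseteq> Sing F h \<union> {P. P \<subseteq> C \<and> h ` P \<in> Sing F g}"
    proof
      fix P assume "P \<in> Sing F (compose C g h)"
      then obtain i x where ix: "i \<in> I" "x \<in> C" "P = adj D i `` {x}"
          "loc i (compose C g h) x \<notin> F i"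
        by (rule singularitiesE)
      then have "loc i h x \<notin> F i \<or> loc i g (h x) \<notin> F i"
        using loc_compose[OF gh ix(1,2)] subgroup.m_closed[OF subgroup_data(1)[OF ix(1)]] by auto
      then show "P \<in> Sing F h \<union> {P. P \<subseteq> C \<and> h ` P \<in> Sing F g}"
      proof
        assume "loc i h x \<notin> F i"
        then show ?thesis using singularitiesI ix by blast
      next
        assume "loc i g (h x) \<notin> F i"
        then have "adj D i `` {h x} \<in> Sing F g"
          by (intro singularitiesI ix aut_in[OF gh(2)])
        then show ?thesis
          using aut_panel[OF gh(2) ix(1,2)] ix(3) panel_subset[OF ix(1)] by simp
      qed
    qed
    moreover have "finite (Sing F h \<union> {P. P \<subseteq> C \<and> h ` P \<in> Sing F g})"
      using g h finite_panel_preimage[OF gh(2)] by (simp add: restricted_iff)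
    ultimately have "finite (Sing F (compose C g h))" by (rule finite_subset)
    moreover have "loc i (compose C g h) x \<in> F' i" if "i \<in> I" "x \<in> C" for i x
      using loc_compose[OF gh that] subgroup.m_closed[OF subgroup_data(2)[OF that(1)]] g h that
        aut_in[OF gh(2) that(2)] by (simp add: restricted_iff)
    ultimately show "g \<otimes>\<^bsub>Aut_group D\<^esub> h \<in> G"
      using gh by (simp add: Aut_mult restricted_iff aut_compose)
  qed
qed

lemma univ_subset_restricted: "univ_group D \<Omega> lam F \<subseteq> G"
proof
  fix g assume "g \<in> univ_group D \<Omega> lam F"
  then have g: "g \<in> aut D" "\<And>i x. i \<in> I \<Longrightarrow> x \<in> C \<Longrightarrow> loc i g x \<in> F i"
    by (auto simp: univ_group_iff)
  have "Sing F g = {}" unfolding singularities_eq using g(2) by blast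
  moreover have "loc i g x \<in> F' i" if "i \<in> I" "x \<in> C" for i x
    using data_mono[OF that(1)] g(2)[OF that] by blast
  ultimately show "g \<in> G" using g(1) by (simp add: restricted_iff)
qed

text \<open>The local action is constant along the wall, so every \<open>i\<close>-panel in it is
  singular. There are finitely many of these, each finite because \<open>\<Omega> i\<close>
  is.\<close>

lemma finite_wall_of_singularity:
  assumes "g \<in> G" "i \<in> I" "x \<in> C" "loc i g x \<notin> F i"
  shows "(\<lambda>y. adj D i `` {y}) ` wall i x \<subseteq> Sing F g" and "finite (wall i x)"
proof -
  have g: "g \<in> aut D" "finite (Sing F g)" using assms(1) by (auto simp: restricted_iff)
  show sub: "(\<lambda>y. adj D i `` {y}) ` wall i x \<subseteq> Sing F g"
  proof (rule image_subsetI)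
    fix y assume y: "y \<in> wall i x"
    have "y \<in> C" using wall_in[OF y] ..
    then show "adj D i `` {y} \<in> Sing F g"
      using loc_wall[OF g(1) assms(2) y] assms(4) by (intro singularitiesI assms(2)) auto
  qed
  have "finite (adj D i `` {y})" if "y \<in> wall i x" for y
    using color_bij[OF assms(2)] finite_colors[OF assms(2)] bij_betw_finite wall_in[OF that] by blast
  moreover have "finite ((\<lambda>y. adj D i `` {y}) ` wall i x)" by (rule finite_subset[OF sub g(2)])
  ultimately have "finite (\<Union>y\<in>wall i x. adj D i `` {y})" by blast
  moreover have "wall i x \<subseteq> (\<Union>y\<in>wall i x. adj D i `` {y})"
    using adj_refl[OF assms(2)] wall_in by blast
  ultimately show "finite (wall i x)" by (rule rev_finite_subset)
qed

lemma singularity_not_rung: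
  assumes "g \<in> G" "i \<in> I" "x \<in> C" "loc i g x \<notin> F i"
  shows "adj D i `` {x} \<in> nonrung_panels m D"
proof -
  have "\<not> is_rung m D (adj D i `` {x})"
  proof
    assume "is_rung m D (adj D i `` {x})"
    then obtain i' j k where r: "i' \<in> I" "adj D i `` {x} \<in> panels D i'" "j \<in> I" "k \<in> I"
      "m i' j = 2" "m i' k = 2" "m j k = \<infinity>"
      unfolding is_rung_def by blast
    then obtain y where "adj D i `` {x} = adj D i' `` {y}"
      unfolding panels_eq[OF r(1)] by blast
    then have "i = i'" by (rule panel_type_unique[OF assms(2) r(1) assms(3)])
    then show False
      using infinite_wall[of i j k x] r assms(2,3) finite_wall_of_singularity(2)[OF assms]
      by (simp add: comm_def)
  qed
  then show ?thesis using assms(2,3) by (auto simp: nonrung_panels_def panels_eq)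
qed

lemma harmonious_transport:
  assumes "j \<in> I" "harmonious D \<Omega> lam F j P P'"
  obtains u where "u \<in> univ_group D \<Omega> lam F" "u ` P' = P"
proof -
  have P: "P \<in> panels D j" "P' \<in> panels D j" using assms(2) by (auto simp: harmonious_def)
  obtain p where p: "p \<in> C" "P = adj D j `` {p}"
    using P(1) unfolding panels_eq[OF assms(1)] by blast
  obtain x where x: "x \<in> C" "P' = adj D j `` {x}"
    using P(2) unfolding panels_eq[OF assms(1)] by blast
  \<comment> \<open>Keeping the \<open>j\<close>-color of \<open>x\<close> lets the identity serve
    for type \<open>j\<close>, about which harmony says nothing.\<close>
  define y where "y = step j (lam j x) p"
  note y = step[OF assms(1) p(1) color_in[OF assms(1) x(1)], folded y_def]
  have "\<exists>f\<in>F k. f (lam k x) = lam k y" if k: "k \<in> I" for k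
  proof (cases "k = j")
    case True
    then show ?thesis
      using y(2) subgroup.one_closed[OF subgroup_data(1)[OF k]] color_in[OF k x(1)]
      by (intro bexI[of _ "\<lambda>a\<in>\<Omega> k. a"]) (simp_all add: BijGroup_def)
  next
    case False
    interpret B: group "BijGroup (\<Omega> k)" by (rule group_BijGroup)
    interpret Fk: subgroup "F k" "BijGroup (\<Omega> k)" by (rule subgroup_data(1)[OF k])
    have "x \<in> P'" "y \<in> P" using p(2) x(2) y(1) adj_refl[OF assms(1) x(1)] by simp_all
    then have "\<exists>B\<in>perm_orbits (\<Omega> k) (F k). lam k y \<in> B \<and> lam k x \<in> B"
      using assms(2) k False unfolding harmonious_def by blast
    then obtain B where B: "B \<in> perm_orbits (\<Omega> k) (F k)" "lam k y \<in> B" "lam k x \<in> B" by blast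
    then obtain w where w: "w \<in> \<Omega> k" "B = {f w | f. f \<in> F k}"
      unfolding perm_orbits_def orbits_def orbit_def by auto
    with B(2,3) obtain f1 f2
      where f: "w \<in> \<Omega> k" "f1 \<in> F k" "f2 \<in> F k" "lam k x = f1 w" "lam k y = f2 w" by blast
    \<comment> \<open>Both colors are images of the base point \<open>w\<close> of the orbit, under
      \<open>f1\<close> and \<open>f2\<close>; the element sought is \<open>f2\<close> after the
      inverse of \<open>f1\<close>.\<close>
    define f3 where "f3 = inv\<^bsub>BijGroup (\<Omega> k)\<^esub> f1"
    have f3: "f3 \<in> F k" unfolding f3_def by (rule Fk.m_inv_closed[OF f(2)])
    have Bij: "f1 \<in> Bij (\<Omega> k)" "f2 \<in> Bij (\<Omega> k)" "f3 \<in> Bij (\<Omega> k)"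
      using Fk.mem_carrier[OF f(2)] Fk.mem_carrier[OF f(3)] Fk.mem_carrier[OF f3]
      by (simp_all add: BijGroup_def)
    have "f1 w \<in> \<Omega> k" by (rule funcset_mem[OF Bij_imp_funcset[OF Bij(1)] f(1)])
    have "f3 \<otimes>\<^bsub>BijGroup (\<Omega> k)\<^esub> f1 = \<one>\<^bsub>BijGroup (\<Omega> k)\<^esub>"
      unfolding f3_def by (rule B.l_inv[OF Fk.mem_carrier[OF f(2)]])
    then have "compose (\<Omega> k) f3 f1 = (\<lambda>a\<in>\<Omega> k. a)" using Bij by (simp add: BijGroup_def)
    then have "compose (\<Omega> k) f3 f1 w = w" using f(1) by simp
    then have "f3 (f1 w) = w" using f(1) by (simp add: compose_eq)
    then have "compose (\<Omega> k) f2 f3 (lam k x) = lam k y"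
      using f \<open>f1 w \<in> \<Omega> k\<close> by (simp add: compose_eq)
    moreover have "compose (\<Omega> k) f2 f3 \<in> F k"
      using Fk.m_closed[OF f(3) f3] Bij by (simp add: BijGroup_def)
    ultimately show ?thesis by blast
  qed
  then obtain u where u: "u \<in> univ_group D \<Omega> lam F" "u x = y"
    using univ_group_transitive[OF x(1) y(3) data(1)] by blast
  have "u \<in> aut D" using u(1) by (simp add: univ_group_iff)
  then have "u ` P' = P"
    using aut_panel[OF _ assms(1) x(1)] u(2) x(2) p(2) panel_eqI[OF assms(1) y(1)] by simp
  then show ?thesis using that u(1) by blast
qed

theorem generated:
  assumes H: "harmony_representatives m D \<Omega> lam F H" and "g \<in> G"
  shows "g \<in> generate (Aut_group D)
    (univ_group D \<Omega> lam F \<union> (\<Union>P\<in>H. panel_group D \<Omega> lam F F' P))" (is "_ \<in> ?gen")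
  using assms(2)
proof (induction "card (Sing F g)" arbitrary: g rule: less_induct)
  case less
  interpret A: group "Aut_group D" by (rule group_Aut)
  interpret G: subgroup G "Aut_group D" by (rule subgroup_restricted)
  have g: "g \<in> aut D" "finite (Sing F g)" using less.prems by (auto simp: restricted_iff)
  show ?case
  proof (cases "Sing F g = {}")
    case True
    then have "loc i g x \<in> F i" if "i \<in> I" "x \<in> C" for i x
      using singularitiesI[OF that] by blast
    then have "g \<in> univ_group D \<Omega> lam F" using g(1) by (simp add: univ_group_iff)
    then show ?thesis by (intro generate.incl UnI1)
  next
    case False
    then obtain P where P: "P \<in> Sing F g" by blast
    then obtain i x where ix: "i \<in> I" "x \<in> C" "P = adj D i `` {x}" "loc i g x \<notin> F i"
      by (rule singularitiesE)
    have "P \<in> nonrung_panels m D" using singularity_not_rung[OF less.prems ix(1,2,4)] ix(3) by simp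
    then have "harmony_rel m D \<Omega> lam F `` {P} \<in> nonrung_panels m D // harmony_rel m D \<Omega> lam F"
      by (rule quotientI)
    then have "\<exists>!P'. P' \<in> H \<inter> harmony_rel m D \<Omega> lam F `` {P}"
      using H unfolding harmony_representatives_def by (elim conjE bspec)
    then obtain P' where P': "P' \<in> H" "(P, P') \<in> harmony_rel m D \<Omega> lam F"
      using ex1_implies_ex by blast
    then obtain j where j: "j \<in> I" "harmonious D \<Omega> lam F j P P'"
      unfolding harmony_rel_def by blast
    then have Pj: "P \<in> panels D j" "P' \<in> panels D j" by (auto simp: harmonious_def)
    \<comment> \<open>\<open>harmony_rel\<close> quantifies the type existentially, but a panel
      determines its type.\<close>
    have "j = i"
      using Pj(1) panel_type_unique[OF ix(1) j(1) ix(2)] unfolding ix(3) panels_eq[OF j(1)] by blast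
    obtain u where u: "u \<in> univ_group D \<Omega> lam F" "u ` P' = P"
      using harmonious_transport[OF j] by blast
    obtain c where c: "c \<in> C" "P' = adj D i `` {c}" 
      using Pj(2) unfolding \<open>j = i\<close> panels_eq[OF ix(1)] by blast
    have uG: "u \<in> G" and ua: "u \<in> aut D" and uF: "\<And>j y. j \<in> I \<Longrightarrow> y \<in> C \<Longrightarrow> loc j u y \<in> F j"
      using u(1) subsetD[OF univ_subset_restricted u(1)] by (simp_all add: univ_group_iff)
    \<comment> \<open>The local actions of \<open>u\<close> lie in \<open>F\<close>, so a panel is
      singular for \<open>g1\<close> exactly when its image under \<open>u\<close> is singular for
      \<open>g\<close>. The singularity \<open>P\<close> is thereby moved to the representative
      \<open>P'\<close>.\<close>
    define g1 where "g1 = g \<otimes>\<^bsub>Aut_group D\<^esub> u"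
    have g1G: "g1 \<in> G" unfolding g1_def by (rule G.m_closed[OF less.prems uG])
    then have g1: "g1 \<in> aut D" "finite (Sing F g1)"
        "\<And>j y. j \<in> I \<Longrightarrow> y \<in> C \<Longrightarrow> loc j g1 y \<in> F' j"
      by (auto simp: restricted_iff)
    have g1_F: "loc j g1 y \<in> F j \<longleftrightarrow> loc j g (u y) \<in> F j" if "j \<in> I" "y \<in> C" for j y
      using loc_compose[OF g(1) ua that] Aut_mult[OF g(1) ua]
        group.mult_mem_subgroup_iff(1)[OF group_BijGroup subgroup_data(1)[OF that(1)] uF[OF that]
          loc_carrier[OF g(1) that(1) aut_in[OF ua that(2)]]] by (simp add: g1_def)
    have sub: "(`) u ` Sing F g1 \<subseteq> Sing F g"
    proof (rule image_subsetI)
      fix Q assume "Q \<in> Sing F g1"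
      then obtain j y where jy: "j \<in> I" "y \<in> C" "Q = adj D j `` {y}" "loc j g1 y \<notin> F j"
        by (rule singularitiesE)
      have "adj D j `` {u y} \<in> Sing F g"
        using g1_F[OF jy(1,2)] jy(4) by (intro singularitiesI jy(1) aut_in[OF ua jy(2)]) simp
      then show "u ` Q \<in> Sing F g" using aut_panel[OF ua jy(1,2)] jy(3) by simp
    qed
    have inj: "inj_on ((`) u) (Pow C)"
      using aut_bij[OF ua] by (intro inj_on_image_Pow) (simp add: bij_betw_def)
    have "Sing F g1 \<subseteq> Pow C"
    proof
      fix Q assume "Q \<in> Sing F g1"
      then show "Q \<in> Pow C" by (rule singularitiesE) (simp add: panel_subset)
    qed
    then have card1: "card (Sing F g1) \<le> card (Sing F g)"
      by (rule card_inj_on_le[OF inj_on_subset[OF inj] sub g(2)])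
    have "adj D i `` {u c} = adj D i `` {x}"
      using aut_panel[OF ua ix(1) c(1)] u(2) c(2) ix(3) by simp
    then have sing1: "loc i g1 c \<notin> F i" using g1_F[OF ix(1) c(1)] ix(4) by simp
    define a where "a = loc i g1 c"
    have a: "a \<in> F' i" "a \<in> young_overgroup (\<Omega> i) (F i)"
      using g1(3)[OF ix(1) c(1)] data_young[OF ix(1)] by (auto simp: a_def)
    obtain h where h: "h \<in> aut D" "h ` (adj D i `` {c}) = adj D i `` {c}"
      "\<And>d. d \<in> wall i c \<Longrightarrow> loc i h d = a"
      "\<And>j d. j \<in> I \<Longrightarrow> d \<in> C \<Longrightarrow> \<not> (j = i \<and> d \<in> wall i c) \<Longrightarrow> loc j h d \<in> F j"
      using wall_automorphism[OF ix(1) c(1) finite_colors[OF ix(1)] data(1) a(2)] by blast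
    have sing_h: "Sing F h \<subseteq> (\<lambda>d. adj D i `` {d}) ` wall i c"
    proof
      fix Q assume "Q \<in> Sing F h"
      then obtain j y where jy: "j \<in> I" "y \<in> C" "Q = adj D j `` {y}" "loc j h y \<notin> F j"
        by (rule singularitiesE)
      then have "j = i" "y \<in> wall i c" using h(4)[OF jy(1,2)] by auto
      with jy(3) show "Q \<in> (\<lambda>d. adj D i `` {d}) ` wall i c" by simp
    qed
    \<comment> \<open>All singularities of \<open>h\<close> lie on the wall of \<open>c\<close>,
      which is finite because \<open>g1\<close> is singular at \<open>c\<close>.\<close>
    have "finite (Sing F h)"
      using finite_wall_of_singularity(2)[OF g1G ix(1) c(1) sing1] by (rule finite_surj[OF _ sing_h])
    moreover have "loc j h d \<in> F' j" if "j \<in> I" "d \<in> C" for j d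
      using h(3)[of d] h(4)[OF that] a(1) data_mono[OF that(1)] by (cases "j = i \<and> d \<in> wall i c") auto
    ultimately have hG: "h \<in> G" using h(1) by (simp add: restricted_iff)
    moreover have "parallel D Q P'" if Q: "Q \<in> Sing F h" for Q
    proof -
      have "Q \<in> (\<lambda>d. adj D i `` {d}) ` wall i c" using sing_h Q by (rule subsetD)
      then show ?thesis
        using parallel_wall[OF ix(1)] unfolding c(2) by (elim imageE) simp
    qed
    ultimately have hK: "h \<in> panel_group D \<Omega> lam F F' P'"
      using h(2) c(2) by (simp add: panel_group_def)
    define g2 where "g2 = g1 \<otimes>\<^bsub>Aut_group D\<^esub> inv\<^bsub>Aut_group D\<^esub> h"
    have carr: "g \<in> carrier (Aut_group D)" "u \<in> carrier (Aut_group D)" "h \<in> carrier (Aut_group D)"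
        "g1 \<in> carrier (Aut_group D)"
      using less.prems uG hG g1G by (simp_all add: G.mem_carrier)
    have g2G: "g2 \<in> G" unfolding g2_def by (intro G.m_closed g1G G.m_inv_closed hG)
    then have g2: "g2 \<in> aut D" by (simp add: restricted_iff)
    have g1_g2: "g1 = g2 \<otimes>\<^bsub>Aut_group D\<^esub> h" using carr by (simp add: g2_def A.m_assoc)
    then have g1_eq: "g1 = compose C g2 h" using Aut_mult[OF g2 h(1)] by simp
    \<comment> \<open>Off the wall \<open>h\<close> acts by elements of \<open>F\<close>, so
      singularities are only carried along by \<open>h\<close>.\<close>
    have "Sing F g2 \<subseteq> (`) h ` (Sing F g1 - {P'})"
    proof
      fix Q assume "Q \<in> Sing F g2"
      then obtain j z where jz: "j \<in> I" "z \<in> C" "Q = adj D j `` {z}" "loc j g2 z \<notin> F j"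
        by (rule singularitiesE)
      have "z \<in> h ` C" using jz(2) bij_betw_imp_surj_on[OF aut_bij[OF h(1)]] by simp
      then obtain y where y: "y \<in> C" "h y = z" by blast
      have loc: "loc j g1 y = loc j g2 z \<otimes>\<^bsub>BijGroup (\<Omega> j)\<^esub> loc j h y"
        using loc_compose[OF g2 h(1) jz(1) y(1)] y(2) g1_eq by simp
      have carr_j: "loc j g2 z \<in> carrier (BijGroup (\<Omega> j))" "loc j h y \<in> carrier (BijGroup (\<Omega> j))"
        by (intro loc_carrier g2 h(1) jz(1,2) y(1))+
      have off: "\<not> (j = i \<and> y \<in> wall i c)"
      proof
        \<comment> \<open>On the wall \<open>h\<close> and \<open>g1\<close> have the same local
          action \<open>a\<close>, which cancels in \<open>g2\<close>.\<close>
        assume on: "j = i \<and> y \<in> wall i c"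
        then have "loc j g1 y = loc j h y"
          using loc_wall[OF g1(1) ix(1)] h(3) by (simp add: a_def)
        then have "loc j g2 z = \<one>\<^bsub>BijGroup (\<Omega> j)\<^esub>"
          using loc group.r_cancel_one'[OF group_BijGroup carr_j(2,1)] by simp
        then show False using jz(4) subgroup.one_closed[OF subgroup_data(1)[OF jz(1)]] by simp
      qed
      then have "loc j g1 y \<notin> F j"
        using loc jz(4) group.mult_mem_subgroup_iff(1)[OF group_BijGroup subgroup_data(1)[OF jz(1)]
          h(4)[OF jz(1) y(1) off] carr_j(1)] by simp
      then have "adj D j `` {y} \<in> Sing F g1" by (rule singularitiesI[OF jz(1) y(1)])
      moreover have "adj D j `` {y} \<noteq> P'"
      proof
        assume eq: "adj D j `` {y} = P'"
        then have "j = i" using panel_type_unique[OF jz(1) ix(1) y(1)] c(2) by simp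
        moreover have "y \<in> P'" using eq adj_refl[OF jz(1) y(1)] by blast
        ultimately show False using off wall_adj[OF ix(1)] c(2) by blast
      qed
      moreover have "Q = h ` (adj D j `` {y})" using aut_panel[OF h(1) jz(1) y(1)] y(2) jz(3) by simp
      ultimately show "Q \<in> (`) h ` (Sing F g1 - {P'})" by blast
    qed
    \<comment> \<open>The whole wall of \<open>P'\<close> has been cleared; losing the one panel
      \<open>P'\<close> is enough for the induction.\<close>
    then have "card (Sing F g2) \<le> card (Sing F g1 - {P'})"
      using surj_card_le[of "Sing F g1 - {P'}"] g1(2) by blast
    also have "\<dots> < card (Sing F g1)"
      using singularitiesI[OF ix(1) c(1) sing1] c(2) by (intro card_Diff1_less g1(2)) simp
    also have "\<dots> \<le> card (Sing F g)" by (rule card1)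
    finally have "g2 \<in> ?gen" by (rule less.hyps[OF _ g2G])
    moreover have "h \<in> ?gen" using hK P'(1) by (intro generate.incl UnI2 UN_I)
    moreover have "inv\<^bsub>Aut_group D\<^esub> u \<in> ?gen" using u(1) by (intro generate.inv UnI1)
    \<comment> \<open>Undo both corrections: \<open>g1\<close> is \<open>g2\<close> times
      \<open>h\<close>, and \<open>g\<close> is \<open>g1\<close> times the inverse of
      \<open>u\<close>.\<close>
    ultimately have "g2 \<otimes>\<^bsub>Aut_group D\<^esub> h \<otimes>\<^bsub>Aut_group D\<^esub> inv\<^bsub>Aut_group D\<^esub> u \<in> ?gen"
      by (intro generate.eng)
    moreover have "g2 \<otimes>\<^bsub>Aut_group D\<^esub> h \<otimes>\<^bsub>Aut_group D\<^esub> inv\<^bsub>Aut_group D\<^esub> u = g"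
      using carr unfolding g1_g2[symmetric] by (simp add: g1_def A.m_assoc)
    ultimately show ?thesis by simp
  qed
qed

end

theorem proposition5p6:
  fixes D :: "('i, 'c) chamber_system"
    and m :: "'i \<Rightarrow> 'i \<Rightarrow> enat"
    and \<delta> :: "'c \<Rightarrow> 'c \<Rightarrow> 'i list set"
    and q :: "'i \<Rightarrow> nat"
    and \<Omega> :: "'i \<Rightarrow> 'o set"
    and lam :: "'i \<Rightarrow> 'c \<Rightarrow> 'o"
    and F F' :: "'i \<Rightarrow> ('o \<Rightarrow> 'o) set"
    and H :: "'c set set"
  assumes "finite (index_set D)"
    and "right_angled_building m D \<delta>"
    and "semiregular D q"
    and "\<And>i. i \<in> index_set D \<Longrightarrow> finite (\<Omega> i) \<and> card (\<Omega> i) = q i"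
    and "legal_coloring D \<Omega> lam"
    and "local_data (index_set D) \<Omega> F"
    and "local_data (index_set D) \<Omega> F'"
    and "\<And>i. i \<in> index_set D \<Longrightarrow> F i \<subseteq> F' i"
    and "\<And>i. i \<in> index_set D \<Longrightarrow> F' i \<subseteq> young_overgroup (\<Omega> i) (F i)"
    and "harmony_representatives m D \<Omega> lam F H"
  shows "restricted_univ_group D \<Omega> lam F F' =
    generate (Aut_group D)
      (univ_group D \<Omega> lam F \<union> (\<Union>P\<in>H. panel_group D \<Omega> lam F F' P))"
proof -
  interpret local_data_building D m \<delta> \<Omega> lam F F'
    by unfold_locales (use assms in auto)
  show ?thesis
  proof
    show "G \<subseteq> generate (Aut_group D)
        (univ_group D \<Omega> lam F \<union> (\<Union>P\<in>H. panel_group D \<Omega> lam F F' P))"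
      using generated[OF assms(10)] by blast
    show "generate (Aut_group D)
        (univ_group D \<Omega> lam F \<union> (\<Union>P\<in>H. panel_group D \<Omega> lam F F' P)) \<subseteq> G"
      by (rule group.generate_subgroup_incl[OF group_Aut _ subgroup_restricted])
        (use univ_subset_restricted in \<open>auto simp: panel_group_def\<close>)
  qed
qed

end
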